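(* Let $Q$ be a simple automorphic $2$-loop. Then $\mathrm{Mlt}(Q)$ is a primitive permutation group on $Q$ of affine type, i.e. it has an abelian regular normal subgroup.
   Context: A loop is a set with a binary operation in which left and right division are uniquely solvable and which has a neutral element $1$. $\mathrm{Mlt}(Q)$ is the group generated by all left translations $x\mapsto ax$ and right translations $x\mapsto xa$, and $\mathrm{Inn}(Q)$ is the stabilizer of $1$ in it; $Q$ is automorphic if $\mathrm{Inn}(Q)\le\mathrm{Aut}(Q)$. A $2$-loop is a finite loop of order $2^m$, $m\ge1$. A loop is simple if it has no normal subloops other than $1$ and itself (a subloop is normal if it is the kernel of a homomorphism). A primitive permutation group is of affine type if it has an abelian regular normal subgroup. *)

theory Defs
  imports "HOL-Algebra.Algebra"
begin

definition loop :: "'a set \<Rightarrow> ('a \<Rightarrow> 'a \<Rightarrow> 'a) \<Rightarrow> 'a \<Rightarrow> bool" where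
  "loop Q m e \<longleftrightarrow>
     (\<forall>x\<in>Q. \<forall>y\<in>Q. m x y \<in> Q) \<and>
     e \<in> Q \<and> (\<forall>x\<in>Q. m e x = x \<and> m x e = x) \<and>
     (\<forall>a\<in>Q. \<forall>b\<in>Q. (\<exists>!x. x \<in> Q \<and> m a x = b)) \<and>
     (\<forall>a\<in>Q. \<forall>b\<in>Q. (\<exists>!y. y \<in> Q \<and> m y a = b))"

definition loop_hom :: "'a set \<Rightarrow> ('a \<Rightarrow> 'a \<Rightarrow> 'a) \<Rightarrow> 'b set \<Rightarrow> ('b \<Rightarrow> 'b \<Rightarrow> 'b) \<Rightarrow> ('a \<Rightarrow> 'b) \<Rightarrow> bool" where
  "loop_hom Q m Q' m' f \<longleftrightarrow> (\<forall>x\<in>Q. f x \<in> Q') \<and> (\<forall>x\<in>Q. \<forall>y\<in>Q. f (m x y) = m' (f x) (f y))"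

text \<open>A normal subloop: the kernel of a loop homomorphism. The target loop is taken on the same
  type as Q; this loses no generality since homomorphic images are no larger than Q.\<close>
definition normal_subloop :: "'a set \<Rightarrow> ('a \<Rightarrow> 'a \<Rightarrow> 'a) \<Rightarrow> 'a \<Rightarrow> 'a set \<Rightarrow> bool" where
  "normal_subloop Q m e N \<longleftrightarrow>
     (\<exists>(Q'::'a set) m' e' f. loop Q' m' e' \<and> loop_hom Q m Q' m' f \<and> N = {x\<in>Q. f x = e'})"

definition simple_loop :: "'a set \<Rightarrow> ('a \<Rightarrow> 'a \<Rightarrow> 'a) \<Rightarrow> 'a \<Rightarrow> bool" where
  "simple_loop Q m e \<longleftrightarrow> loop Q m e \<and>
     (\<forall>N. normal_subloop Q m e N \<longrightarrow> N = {e} \<or> N = Q)"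

definition two_loop :: "'a set \<Rightarrow> ('a \<Rightarrow> 'a \<Rightarrow> 'a) \<Rightarrow> 'a \<Rightarrow> bool" where
  "two_loop Q m e \<longleftrightarrow> loop Q m e \<and> finite Q \<and> (\<exists>k::nat. k \<ge> 1 \<and> card Q = 2 ^ k)"

definition Ltr :: "'a set \<Rightarrow> ('a \<Rightarrow> 'a \<Rightarrow> 'a) \<Rightarrow> 'a \<Rightarrow> 'a \<Rightarrow> 'a" where
  "Ltr Q m a = (\<lambda>x\<in>Q. m a x)"

definition Rtr :: "'a set \<Rightarrow> ('a \<Rightarrow> 'a \<Rightarrow> 'a) \<Rightarrow> 'a \<Rightarrow> 'a \<Rightarrow> 'a" where
  "Rtr Q m a = (\<lambda>x\<in>Q. m x a)"

definition Mlt :: "'a set \<Rightarrow> ('a \<Rightarrow> 'a \<Rightarrow> 'a) \<Rightarrow> ('a \<Rightarrow> 'a) monoid" where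
  "Mlt Q m = (BijGroup Q)\<lparr>carrier :=
      generate (BijGroup Q) ((Ltr Q m ` Q) \<union> (Rtr Q m ` Q))\<rparr>"

definition Inn :: "'a set \<Rightarrow> ('a \<Rightarrow> 'a \<Rightarrow> 'a) \<Rightarrow> 'a \<Rightarrow> ('a \<Rightarrow> 'a) set" where
  "Inn Q m e = {g \<in> carrier (Mlt Q m). g e = e}"

definition automorphic_loop :: "'a set \<Rightarrow> ('a \<Rightarrow> 'a \<Rightarrow> 'a) \<Rightarrow> 'a \<Rightarrow> bool" where
  "automorphic_loop Q m e \<longleftrightarrow> loop Q m e \<and>
     (\<forall>g \<in> Inn Q m e. bij_betw g Q Q \<and> (\<forall>x\<in>Q. \<forall>y\<in>Q. g (m x y) = m (g x) (g y)))"

text \<open>Permutation groups: G is a group whose elements are permutations of S, composition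
  being the group operation (as in subgroups of BijGroup S).\<close>
definition perm_transitive :: "('a \<Rightarrow> 'a) monoid \<Rightarrow> 'a set \<Rightarrow> bool" where
  "perm_transitive G S \<longleftrightarrow> (\<forall>x\<in>S. \<forall>y\<in>S. \<exists>g\<in>carrier G. g x = y)"

definition block :: "('a \<Rightarrow> 'a) monoid \<Rightarrow> 'a set \<Rightarrow> 'a set \<Rightarrow> bool" where
  "block G S B \<longleftrightarrow> B \<subseteq> S \<and> B \<noteq> {} \<and>
     (\<forall>g\<in>carrier G. g ` B = B \<or> g ` B \<inter> B = {})"

definition perm_primitive :: "('a \<Rightarrow> 'a) monoid \<Rightarrow> 'a set \<Rightarrow> bool" where
  "perm_primitive G S \<longleftrightarrow> perm_transitive G S \<and>
     (\<forall>B. block G S B \<longrightarrow> card B = 1 \<or> B = S)"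

definition perm_regular :: "('a \<Rightarrow> 'a) monoid \<Rightarrow> ('a \<Rightarrow> 'a) set \<Rightarrow> 'a set \<Rightarrow> bool" where
  "perm_regular G A S \<longleftrightarrow> (\<forall>x\<in>S. \<forall>y\<in>S. \<exists>!a. a \<in> A \<and> a x = y)"

definition affine_type :: "('a \<Rightarrow> 'a) monoid \<Rightarrow> 'a set \<Rightarrow> bool" where
  "affine_type G S \<longleftrightarrow> (\<exists>A. A \<lhd> G \<and> (\<forall>a\<in>A. \<forall>b\<in>A. a \<otimes>\<^bsub>G\<^esub> b = b \<otimes>\<^bsub>G\<^esub> a) \<and>
                              perm_regular G A S)"

end

theory Submission
  imports Defs
begin

text \<open>
  A normal subloop is the class of \<open>e\<close> under a \<open>Mlt(Q)\<close>-invariant equivalence, so simplicity gives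
  primitivity, and it remains to find a nontrivial normal \<open>2\<close>-subgroup of \<open>Mlt(Q)\<close>: its center is
  abelian and normal, hence transitive, hence regular.

  Inversion \<open>J\<close> is an antiautomorphism of \<open>Q\<close>, so it normalizes \<open>Mlt(Q)\<close> and centralizes \<open>Inn(Q)\<close>.
  In \<open>\<Gamma> = Mlt(Q)\<langle>J\<rangle>\<close> a Sylow \<open>2\<close>-subgroup is transitive on the \<open>2^n\<close> points, so if it
  contains one conjugate of \<open>J\<close> it contains all of them, and they generate a normal \<open>2\<close>-subgroup.
  It meets \<open>Mlt(Q)\<close> nontrivially unless \<open>L x = R (J x)\<close> for all \<open>x\<close>, that is, unless \<open>Q\<close> is
  commutative of exponent \<open>2\<close>.

  In that case one first finds \<open>v \<noteq> e\<close> whose translation \<open>s = L v\<close> is an involution. By Baer's theorem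
  on involutions, \<open>s\<close> lies in a normal \<open>2\<close>-subgroup if every product of \<open>s\<close> with a conjugate is a
  \<open>2\<close>-element. Otherwise \<open>s\<close> inverts a permutation of odd prime order; the latter fixes a point
  since \<open>|Q|\<close> is a power of \<open>2\<close>, and moving that point to \<open>e\<close> gives an inner mapping of odd order
  inverted by a commutator \<open>[s, L z]\<close>, which the identities between such commutators exclude.
\<close>

section \<open>Finite 2-groups\<close>

lemma (in group) group_action_restrict:
  assumes closed: "\<And>g x. \<lbrakk>g \<in> carrier G; x \<in> W\<rbrakk> \<Longrightarrow> f g x \<in> W"
    and one: "\<And>x. x \<in> W \<Longrightarrow> f \<one> x = x"
    and mult: "\<And>g h x. \<lbrakk>g \<in> carrier G; h \<in> carrier G; x \<in> W\<rbrakk> \<Longrightarrow> f (g \<otimes> h) x = f g (f h x)"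
  shows "group_action G W (\<lambda>g. restrict (f g) W)"
proof -
  have inv1: "f (inv g) (f g x) = x" if "g \<in> carrier G" "x \<in> W" for g x
    using mult[of "inv g" g x] one that by simp
  have inv2: "f g (f (inv g) x) = x" if "g \<in> carrier G" "x \<in> W" for g x
    using mult[of g "inv g" x] one that by simp
  have bij: "restrict (f g) W \<in> Bij W" if g: "g \<in> carrier G" for g
  proof -
    have "bij_betw (f g) W W"
      by (rule bij_betwI[where g = "f (inv g)"]) (use g closed inv1 inv2 in auto)
    then show ?thesis by (simp add: Bij_def)
  qed
  have "(\<lambda>g. restrict (f g) W) \<in> hom G (BijGroup W)"
  proof (rule homI)
    fix g h assume gh: "g \<in> carrier G" "h \<in> carrier G"
    then have "restrict (f (g \<otimes> h)) W = compose W (restrict (f g) W) (restrict (f h) W)"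
      by (auto simp: fun_eq_iff compose_def mult closed)
    then show "restrict (f (g \<otimes> h)) W = restrict (f g) W \<otimes>\<^bsub>BijGroup W\<^esub> restrict (f h) W"
      using gh bij by (simp add: BijGroup_def)
  qed (use bij in \<open>simp add: BijGroup_def\<close>)
  then show ?thesis
    by (simp add: group_action_def group_hom_def group_hom_axioms_def group_BijGroup)
qed

text \<open>Every orbit has size dividing \<open>p ^ n\<close>. An orbit through a point that is not
  fixed is no singleton, so its size is a multiple of \<open>p\<close>, and these orbits partition
  the complement of the fixed points.\<close>

lemma (in group_action) prime_power_fixed_points:
  assumes "finite E" "Factorial_Ring.prime p" "order G = p ^ n"
  shows "card E mod p = card {x \<in> E. \<forall>g\<in>carrier G. \<phi> g x = x} mod p"
proof -
  define F where "F = {x \<in> E. \<forall>g\<in>carrier G. \<phi> g x = x}"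
  have FE: "F \<subseteq> E" by (auto simp: F_def)
  define C where "C = orbit G \<phi> ` (E - F)"
  interpret group_hom G "BijGroup E" \<phi> by (rule group_hom)
  have refl: "x \<in> orbit G \<phi> x" if "x \<in> E" for x
    using orbit_refl that by blast
  have sub: "orbit G \<phi> x \<subseteq> E" if "x \<in> E" for x
    using element_image that by (auto simp: orbit_def)
  have orbF: "orbit G \<phi> x = {x}" if "x \<in> F" for x
    using that refl by (auto simp: orbit_def F_def)
  have avoid: "orbit G \<phi> x \<subseteq> E - F" if x: "x \<in> E - F" for x
  proof
    fix y assume y: "y \<in> orbit G \<phi> x"
    then have yE: "y \<in> E" using sub x by auto
    have "y \<notin> F"
    proof
      assume "y \<in> F"
      moreover have "x \<in> orbit G \<phi> y" using orbit_sym x yE y by blast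
      ultimately show False using orbF x by auto
    qed
    then show "y \<in> E - F" using yE by auto
  qed
  have "\<Union>C = E - F" using avoid refl by (fastforce simp: C_def)
  moreover have "p dvd card (\<Union>C)"
  proof (rule dvd_partition)
    show "finite (\<Union>C)" using assms \<open>\<Union>C = E - F\<close> by simp
    show "\<forall>c\<in>C. p dvd card c"
    proof
      fix c assume "c \<in> C"
      then obtain x where x: "x \<in> E - F" "c = orbit G \<phi> x" by (auto simp: C_def)
      then have "card c dvd p ^ n"
        using orbit_stabilizer_theorem[of x] assms by (metis DiffD1 dvd_triv_left)
      moreover have "card c \<noteq> 1"
      proof
        assume "card c = 1"
        then obtain y where "c = {y}" by (auto simp: card_1_singleton_iff)
        then have "orbit G \<phi> x = {x}" using refl[of x] x by auto
        then have "\<forall>g\<in>carrier G. \<phi> g x = x" by (auto simp: orbit_def)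
        then show False using x by (auto simp: F_def)
      qed
      ultimately show "p dvd card c"
        using assms(2) by (metis divides_primepow_nat dvd_power power_eq_0_iff power_0 gr0I)
    qed
    show "\<forall>c1\<in>C. \<forall>c2\<in>C. c1 \<noteq> c2 \<longrightarrow> c1 \<inter> c2 = {}"
      using disjoint_union by (auto simp: C_def orbits_def)
  qed
  moreover have "card E = card F + card (E - F)"
    using FE assms(1) by (metis card_Un_disjoint Diff_disjoint Un_Diff_cancel finite_Diff finite_subset sup.absorb2)
  ultimately show ?thesis unfolding F_def[symmetric] by (simp add: mod_eq_0_iff_dvd[symmetric] mod_add_eq) (metis add.right_neutral mod_0_imp_dvd mod_add_right_eq)
qed

lemma (in group) subgroup_action:
  assumes K: "subgroup K G"
    and "\<And>g x. \<lbrakk>g \<in> K; x \<in> W\<rbrakk> \<Longrightarrow> f g x \<in> W"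
    and "\<And>x. x \<in> W \<Longrightarrow> f \<one> x = x"
    and "\<And>g h x. \<lbrakk>g \<in> K; h \<in> K; x \<in> W\<rbrakk> \<Longrightarrow> f (g \<otimes> h) x = f g (f h x)"
  shows "group_action (G\<lparr>carrier := K\<rparr>) W (\<lambda>g. restrict (f g) W)"
proof -
  interpret K: group "G\<lparr>carrier := K\<rparr>"
    by (rule subgroup.subgroup_is_group[OF K group_axioms])
  show ?thesis
    by (rule K.group_action_restrict) (use assms in auto)
qed

text \<open>The form used below: the action is any map obeying the axioms on \<open>W\<close>, and
  \<open>restrict\<close> supplies the extensional permutations that \<open>BijGroup\<close>
  demands.\<close>

lemma (in group) prime_power_fixed_points:
  assumes "subgroup K G" "Factorial_Ring.prime p" "card K = p ^ n" "finite W"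
    and "\<And>g x. \<lbrakk>g \<in> K; x \<in> W\<rbrakk> \<Longrightarrow> f g x \<in> W"
    and "\<And>x. x \<in> W \<Longrightarrow> f \<one> x = x"
    and "\<And>g h x. \<lbrakk>g \<in> K; h \<in> K; x \<in> W\<rbrakk> \<Longrightarrow> f (g \<otimes> h) x = f g (f h x)"
  shows "card W mod p = card {x \<in> W. \<forall>g\<in>K. f g x = x} mod p"
proof -
  have "card W mod p = card {x \<in> W. \<forall>g\<in>K. restrict (f g) W x = x} mod p"
    using group_action.prime_power_fixed_points[OF subgroup_action[of K W f]] assms
    by (simp add: order_def)
  also have "{x \<in> W. \<forall>g\<in>K. restrict (f g) W x = x} = {x \<in> W. \<forall>g\<in>K. f g x = x}"
    by auto
  finally show ?thesis .
qed

section \<open>2-subgroups: normalizers, centers and products\<close>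

lemma even_card_other_point:
  assumes "finite W" "even (card W)" "x \<in> W"
  shows "\<exists>y\<in>W. y \<noteq> x"
proof (rule ccontr)
  assume "\<not> (\<exists>y\<in>W. y \<noteq> x)"
  then have "W = {x}" using assms(3) by blast
  then show False using assms(2) by simp
qed

text \<open>An infinite set has cardinality 0, so the power of two forces finiteness; exponent 0
  admits the trivial subgroup.\<close>

definition two_subgroup :: "('a, 'b) monoid_scheme \<Rightarrow> 'a set \<Rightarrow> bool" where
  "two_subgroup G K \<longleftrightarrow> subgroup K G \<and> (\<exists>n::nat. card K = 2 ^ n)"

lemma two_subgroup_finite: "two_subgroup G K \<Longrightarrow> finite K"
  by (metis two_subgroup_def card.infinite power_not_zero zero_neq_numeral)

lemma (in group) card_subgroup_dvd:
  assumes "subgroup K G" "subgroup H G" "H \<subseteq> K"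
  shows "card H dvd card K"
proof -
  interpret K: group "G\<lparr>carrier := K\<rparr>"
    by (rule subgroup.subgroup_is_group[OF assms(1) group_axioms])
  have "subgroup H (G\<lparr>carrier := K\<rparr>)" using assms subgroup_incl by blast
  then show ?thesis
    using K.lagrange[of H] by (metis dvd_triv_right order_def partial_object.simps(1) partial_object.update_convs(1) partial_object.surjective)
qed

lemma (in group) two_subgroup_mono:
  assumes "two_subgroup G K" "subgroup H G" "H \<subseteq> K"
  shows "two_subgroup G H"
  using card_subgroup_dvd[of K H] assms divides_primepow_nat[OF two_is_prime_nat]
  unfolding two_subgroup_def by metis

lemma (in group) cancel_left [simp]:
  "\<lbrakk>x \<in> carrier G; y \<in> carrier G\<rbrakk> \<Longrightarrow> x \<otimes> (inv x \<otimes> y) = y"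
  "\<lbrakk>x \<in> carrier G; y \<in> carrier G\<rbrakk> \<Longrightarrow> inv x \<otimes> (x \<otimes> y) = y"
  by (simp_all add: m_assoc[symmetric])

text \<open>The normalizer of an arbitrary subset. Both conjugations are demanded because for
  infinite \<open>M\<close> one inclusion does not give the other.\<close>

definition nrm :: "('a, 'b) monoid_scheme \<Rightarrow> 'a set \<Rightarrow> 'a set" where
  "nrm G M = {g \<in> carrier G. \<forall>h\<in>M. g \<otimes>\<^bsub>G\<^esub> h \<otimes>\<^bsub>G\<^esub> inv\<^bsub>G\<^esub> g \<in> M \<and> inv\<^bsub>G\<^esub> g \<otimes>\<^bsub>G\<^esub> h \<otimes>\<^bsub>G\<^esub> g \<in> M}"

lemma (in group) subgroup_nrm:
  assumes "M \<subseteq> carrier G"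
  shows "subgroup (nrm G M) G"
proof (rule subgroupI)
  show "nrm G M \<noteq> {}"
    using assms by (auto simp: nrm_def intro!: exI[of _ \<one>] simp: subsetD)
next
  fix a b assume ab: "a \<in> nrm G M" "b \<in> nrm G M"
  then have c: "a \<in> carrier G" "b \<in> carrier G" by (auto simp: nrm_def)
  have "a \<otimes> b \<otimes> h \<otimes> inv (a \<otimes> b) = a \<otimes> (b \<otimes> h \<otimes> inv b) \<otimes> inv a"
    "inv (a \<otimes> b) \<otimes> h \<otimes> (a \<otimes> b) = inv b \<otimes> (inv a \<otimes> h \<otimes> a) \<otimes> b" if "h \<in> M" for h
    using c subsetD[OF assms that] by (simp_all add: m_assoc inv_mult_group)
  then show "a \<otimes> b \<in> nrm G M"
    using ab c by (auto simp: nrm_def)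
qed (auto simp: nrm_def)

lemma (in group) subgroup_le_nrm:
  assumes "subgroup M G"
  shows "M \<subseteq> nrm G M"
  using assms by (auto simp: nrm_def subgroup.mem_carrier subgroup.m_closed subgroup.m_inv_closed)

lemma (in group) nrm_generate:
  assumes "Y \<subseteq> carrier G"
  shows "nrm G Y \<subseteq> nrm G (generate G Y)"
proof -
  have *: "g \<otimes> h \<otimes> inv g \<in> generate G Y"
    if g: "g \<in> carrier G" "\<And>h. h \<in> Y \<Longrightarrow> g \<otimes> h \<otimes> inv g \<in> Y" and h: "h \<in> generate G Y" for g h
    using h
  proof (induct h rule: generate.induct)
    case one
    then show ?case using g generate.one by auto
  next
    case (incl h)
    then show ?case using g generate.incl by metis
  next
    case (inv h)
    then have "h \<in> carrier G" using assms by auto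
    then have "g \<otimes> inv h \<otimes> inv g = inv (g \<otimes> h \<otimes> inv g)"
      using g by (simp add: m_assoc inv_mult_group)
    then show ?case using generate.inv[OF g(2)[OF inv]] by metis
  next
    case (eng h1 h2)
    then have "h1 \<in> carrier G" "h2 \<in> carrier G"
      using generate_in_carrier assms by auto
    then have "g \<otimes> (h1 \<otimes> h2) \<otimes> inv g = (g \<otimes> h1 \<otimes> inv g) \<otimes> (g \<otimes> h2 \<otimes> inv g)"
      using g by (simp add: m_assoc)
    then show ?case using generate.eng[OF eng(2,4)] by metis
  qed
  show ?thesis
  proof
    fix g assume g: "g \<in> nrm G Y"
    then have c: "g \<in> carrier G" by (auto simp: nrm_def)
    show "g \<in> nrm G (generate G Y)"
      using g c *[of g] *[of "inv g"] by (auto simp: nrm_def)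
  qed
qed

text \<open>Let \<open>M\<close> act by right multiplication on its right cosets in
  \<open>K\<close>. Their number is a power of 2 other than 1, so the number of fixed cosets is
  even. \<open>M\<close> is one of them, and another fixed coset \<open>M #> a\<close> yields an
  \<open>a\<close> outside \<open>M\<close> that normalizes \<open>M\<close>.\<close>

lemma (in group) two_subgroup_normalizer_grows:
  assumes K: "two_subgroup G K" and M: "subgroup M G" "M \<subset> K"
  shows "\<exists>x\<in>K - M. x \<in> nrm G M"
proof -
  have sK: "subgroup K G" and finK: "finite K"
    using K two_subgroup_finite by (auto simp: two_subgroup_def)
  interpret K: group "G\<lparr>carrier := K\<rparr>"
    by (rule subgroup.subgroup_is_group[OF sK group_axioms])
  have MK: "subgroup M (G\<lparr>carrier := K\<rparr>)" using M sK subgroup_incl by blast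
  have Kc: "K \<subseteq> carrier G" using sK subgroup.subset by blast
  obtain n where n: "card M = 2 ^ n"
    using two_subgroup_mono[OF K M(1)] M by (auto simp: two_subgroup_def)
  define W where "W = (\<lambda>a. M #> a) ` K"
  have finX: "finite W" using finK by (simp add: W_def)
  have XR: "W = rcosets\<^bsub>G\<lparr>carrier := K\<rparr>\<^esub> M"
    by (auto simp: W_def RCOSETS_def r_coset_def)
  have lag: "card W * card M = card K"
    using K.lagrange[OF MK] by (simp add: XR order_def)
  have "card W \<noteq> 1"
    using lag M(2) finK by (metis mult_1 psubset_card_mono nat_neq_iff)
  moreover have "\<exists>k. card W = 2 ^ k"
    using lag K divides_primepow_nat[OF two_is_prime_nat] unfolding two_subgroup_def by (metis dvd_triv_left)
  ultimately have evX: "even (card W)"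
    by (metis even_power even_numeral power_0 gr0I)
  define F where "F = {Y \<in> W. \<forall>g\<in>M. Y #> inv g = Y}"
  have "card W mod 2 = card F mod 2"
    unfolding F_def
  proof (rule prime_power_fixed_points[where n = n])
    show "subgroup M G" "Factorial_Ring.prime (2::nat)" "card M = 2 ^ n" "finite W"
      using M n finX by auto
    fix g Y assume g: "g \<in> M" and "Y \<in> W"
    then obtain a where a: "a \<in> K" "Y = M #> a" by (auto simp: W_def)
    have gK: "g \<in> K" using g M by auto
    have "Y #> inv g = M #> (a \<otimes> inv g)"
      using a g gK Kc M by (simp add: coset_mult_assoc subgroup.subset subsetD)
    then show "Y #> inv g \<in> W"
      using a gK sK by (auto simp: W_def subgroup.m_closed subgroup.m_inv_closed)
  next
    fix Y assume "Y \<in> W"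
    then have "Y \<subseteq> carrier G"
      using Kc M by (auto simp: W_def r_coset_def subset_iff subgroup.mem_carrier)
    then show "Y #> inv \<one> = Y" by simp
  next
    fix g h Y assume gh: "g \<in> M" "h \<in> M" and "Y \<in> W"
    then have "Y \<subseteq> carrier G"
      using Kc M by (auto simp: W_def r_coset_def subset_iff subgroup.mem_carrier)
    moreover have "g \<in> carrier G" "h \<in> carrier G" using gh subgroup.mem_carrier[OF M(1)] by auto
    ultimately show "Y #> inv (g \<otimes> h) = Y #> inv h #> inv g"
      by (simp add: inv_mult_group coset_mult_assoc)
  qed
  then have evF: "even (card F)" using evX by presburger
  have oneK: "\<one> \<in> K" using sK subgroup.one_closed by blast
  have "M = M #> \<one>" using M(1) by (simp add: subgroup.subset)
  then have "M \<in> W" using oneK unfolding W_def by blast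
  moreover have "M #> inv g = M" if "g \<in> M" for g
    using that M(1) by (simp add: coset_join2 subgroup.m_inv_closed subgroup.mem_carrier)
  ultimately have "M \<in> F" by (auto simp: F_def)
  moreover have "finite F" using finX by (auto simp: F_def)
  ultimately obtain Y where Y: "Y \<in> F" "Y \<noteq> M" using evF even_card_other_point by metis
  then obtain a where a: "a \<in> K" "Y = M #> a" by (auto simp: F_def W_def)
  have ac: "a \<in> carrier G" using a Kc by auto
  have aM: "a \<notin> M" using Y a M(1) ac coset_join2 by metis
  have conj: "a \<otimes> g \<otimes> inv a \<in> M" if g: "g \<in> M" for g
  proof -
    have gc: "g \<in> carrier G" using g subgroup.mem_carrier[OF M(1)] by auto
    have "M #> a #> inv (inv g) = M #> a"
      using Y a g M(1) by (auto simp: F_def subgroup.m_inv_closed)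
    then have "M #> (a \<otimes> g) = M #> a"
      using ac gc M(1) by (simp add: coset_mult_assoc subgroup.subset)
    then have "a \<otimes> g \<in> M #> a"
      using rcos_self[of "a \<otimes> g" M] ac gc M(1) by auto
    then obtain h where "h \<in> M" "a \<otimes> g = h \<otimes> a" by (auto simp: r_coset_def)
    then show ?thesis using ac M(1) subgroup.mem_carrier by (simp add: m_assoc subgroup.mem_carrier)
  qed
  have finM: "finite M" using finK M finite_subset by blast
  \<comment> \<open>So far conjugation by \<open>a\<close> only maps \<open>M\<close> into itself;
    on the finite set \<open>M\<close> it is then onto, which gives the inverse conjugation required
    by \<open>nrm\<close>.\<close>
  have "inj_on (\<lambda>g. a \<otimes> g \<otimes> inv a) M"
    using ac M(1) by (auto intro!: inj_onI simp: subgroup.mem_carrier)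
  then have surj: "(\<lambda>g. a \<otimes> g \<otimes> inv a) ` M = M"
    using conj finM by (intro endo_inj_surj) auto
  have "a \<in> nrm G M" unfolding nrm_def mem_Collect_eq
  proof (intro conjI ballI ac conj)
    fix g assume g: "g \<in> M"
    then have "g \<in> (\<lambda>g. a \<otimes> g \<otimes> inv a) ` M" by (simp only: surj)
    then obtain h where "h \<in> M" "g = a \<otimes> h \<otimes> inv a" by (rule imageE)
    then show "inv a \<otimes> g \<otimes> a \<in> M" using ac M(1) by (simp add: m_assoc subgroup.mem_carrier)
  qed
  then show ?thesis using a aM by blast
qed

text \<open>The central elements are the fixed points of \<open>K\<close> acting on itself by
  conjugation; their number is even and \<open>\<one>\<close> is among them.\<close>

lemma (in group) two_subgroup_center:
  assumes K: "two_subgroup G K" "K \<noteq> {\<one>}"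
  shows "\<exists>z\<in>K. z \<noteq> \<one> \<and> (\<forall>k\<in>K. k \<otimes> z = z \<otimes> k)"
proof -
  have sK: "subgroup K G" and finK: "finite K"
    using K two_subgroup_finite by (auto simp: two_subgroup_def)
  obtain n where n: "card K = 2 ^ n" using K by (auto simp: two_subgroup_def)
  have oneK: "\<one> \<in> K" using sK subgroup.one_closed by blast
  have "card K \<noteq> 1" using K(2) oneK by (auto simp: card_1_singleton_iff)
  then have ev: "even (card K)" using n by (metis even_power even_numeral power_0 gr0I)
  define F where "F = {z \<in> K. \<forall>k\<in>K. k \<otimes> z \<otimes> inv k = z}"
  have "card K mod 2 = card F mod 2"
    unfolding F_def
  proof (rule prime_power_fixed_points[OF sK two_is_prime_nat n finK])
    fix g x assume "g \<in> K" "x \<in> K"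
    then show "g \<otimes> x \<otimes> inv g \<in> K"
      using sK by (simp add: subgroup.m_closed subgroup.m_inv_closed)
  next
    fix x assume "x \<in> K"
    then show "\<one> \<otimes> x \<otimes> inv \<one> = x" using sK by (simp add: subgroup.mem_carrier)
  next
    fix g h x assume "g \<in> K" "h \<in> K" "x \<in> K"
    then show "g \<otimes> h \<otimes> x \<otimes> inv (g \<otimes> h) = g \<otimes> (h \<otimes> x \<otimes> inv h) \<otimes> inv g"
      using sK by (simp add: subgroup.mem_carrier m_assoc inv_mult_group)
  qed
  then have "even (card F)" using ev by presburger
  moreover have "\<one> \<in> F" using oneK sK by (auto simp: F_def subgroup.mem_carrier)
  moreover have "finite F" using finK by (auto simp: F_def)
  ultimately obtain z where z: "z \<in> F" "z \<noteq> \<one>" using even_card_other_point by metis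
  have "k \<otimes> z = z \<otimes> k" if "k \<in> K" for k
  proof -
    have "k \<otimes> z \<otimes> inv k = z" "k \<in> carrier G" "z \<in> carrier G"
      using that z sK by (auto simp: F_def subgroup.mem_carrier)
    then show ?thesis by (metis inv_solve_right m_closed)
  qed
  then show ?thesis using z by (auto simp: F_def)
qed

lemma (in group) subgroup_set_mult:
  assumes sA: "subgroup A G" and sB: "subgroup B G" and n: "B \<subseteq> nrm G A"
  shows "subgroup (A <#> B) G"
proof -
  note [simp] = subgroup.mem_carrier[OF sA] subgroup.mem_carrier[OF sB]
    subgroup.m_closed[OF sA] subgroup.m_closed[OF sB]
    subgroup.m_inv_closed[OF sA] subgroup.m_inv_closed[OF sB]
    subgroup.one_closed[OF sA] subgroup.one_closed[OF sB]
  have conj: "b \<otimes> a \<otimes> inv b \<in> A" "inv b \<otimes> a \<otimes> b \<in> A" if "a \<in> A" "b \<in> B" for a b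
    using n that by (auto simp: nrm_def)
  show ?thesis
  proof (rule subgroupI)
    show "A <#> B \<subseteq> carrier G" by (auto simp: set_mult_def)
    have "\<one> \<otimes> \<one> \<in> A <#> B"
      unfolding set_mult_def using subgroup.one_closed[OF sA] subgroup.one_closed[OF sB] by blast
    then show "A <#> B \<noteq> {}" by blast
  next
    fix x assume "x \<in> A <#> B"
    then obtain a b where ab: "a \<in> A" "b \<in> B" "x = a \<otimes> b" by (auto simp: set_mult_def)
    then have "inv x = (inv b \<otimes> inv a \<otimes> b) \<otimes> inv b" by (simp add: m_assoc inv_mult_group)
    moreover have "inv b \<otimes> inv a \<otimes> b \<in> A" "inv b \<in> B" using conj ab by simp_all
    ultimately show "inv x \<in> A <#> B" unfolding set_mult_def by blast
  next
    fix x y assume "x \<in> A <#> B" "y \<in> A <#> B"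
    then obtain a b c d where ab: "a \<in> A" "b \<in> B" "x = a \<otimes> b" "c \<in> A" "d \<in> B" "y = c \<otimes> d"
      by (auto simp: set_mult_def)
    then have "x \<otimes> y = (a \<otimes> (b \<otimes> c \<otimes> inv b)) \<otimes> (b \<otimes> d)"
      by (simp add: m_assoc)
    moreover have "a \<otimes> (b \<otimes> c \<otimes> inv b) \<in> A" "b \<otimes> d \<in> B" using conj ab by simp_all
    ultimately show "x \<otimes> y \<in> A <#> B" unfolding set_mult_def by blast
  qed
qed

lemma (in group) two_subgroup_set_mult:
  assumes A: "two_subgroup G A" and B: "two_subgroup G B" and n: "B \<subseteq> nrm G A"
  shows "two_subgroup G (A <#> B)"
proof -
  have sA: "subgroup A G" and sB: "subgroup B G"
    using A B by (auto simp: two_subgroup_def)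
  note [simp] = subgroup.mem_carrier[OF sA] subgroup.mem_carrier[OF sB]
    subgroup.m_closed[OF sA] subgroup.m_closed[OF sB]
    subgroup.m_inv_closed[OF sA] subgroup.m_inv_closed[OF sB]
    subgroup.one_closed[OF sA] subgroup.one_closed[OF sB]
  have sub: "subgroup (A <#> B) G" by (rule subgroup_set_mult[OF sA sB n])
  \<comment> \<open>\<open>A \<times> B\<close> acts transitively on \<open>A <#> B\<close>, so the cardinality of the latter divides that of the former.\<close>
  define D where "D = (G\<lparr>carrier := A\<rparr>) \<times>\<times> (G\<lparr>carrier := B\<rparr>)"
  interpret D: group D
    unfolding D_def
    by (intro DirProd_group subgroup.subgroup_is_group sA sB group_axioms)
  define f where "f = (\<lambda>g x. fst g \<otimes> x \<otimes> inv (snd g))"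
  have act: "group_action D (A <#> B) (\<lambda>g. restrict (f g) (A <#> B))"
  proof (rule D.group_action_restrict)
    fix g x assume "g \<in> carrier D" "x \<in> A <#> B"
    then obtain a b c d where ab: "a \<in> A" "b \<in> B" "x = a \<otimes> b" "c \<in> A" "d \<in> B" "g = (c, d)"
      by (auto simp: set_mult_def D_def DirProd_def)
    then have "f g x = (c \<otimes> a) \<otimes> (b \<otimes> inv d)" by (simp add: f_def m_assoc)
    moreover have "c \<otimes> a \<in> A" "b \<otimes> inv d \<in> B" using ab by simp_all
    ultimately show "f g x \<in> A <#> B" unfolding set_mult_def by blast
  next
    fix x assume "x \<in> A <#> B"
    then show "f \<one>\<^bsub>D\<^esub> x = x" using sub by (simp add: f_def D_def DirProd_def subgroup.mem_carrier)
  next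
    fix g h x assume "g \<in> carrier D" "h \<in> carrier D" "x \<in> A <#> B"
    then show "f (g \<otimes>\<^bsub>D\<^esub> h) x = f g (f h x)"
      using subgroup.mem_carrier[OF sub]
      by (auto simp: f_def D_def DirProd_def m_assoc inv_mult_group)
  qed
  have oneAB: "\<one> \<in> A <#> B" using sub subgroup.one_closed by blast
  have orb: "orbit D (\<lambda>g. restrict (f g) (A <#> B)) \<one> = A <#> B"
  proof
    show "orbit D (\<lambda>g. restrict (f g) (A <#> B)) \<one> \<subseteq> A <#> B"
      unfolding orbit_def using group_action.element_image[OF act _ oneAB] by blast
    show "A <#> B \<subseteq> orbit D (\<lambda>g. restrict (f g) (A <#> B)) \<one>"
    proof
      fix x assume "x \<in> A <#> B"
      then obtain a b where ab: "a \<in> A" "b \<in> B" "x = a \<otimes> b" by (auto simp: set_mult_def)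
      then have "x = restrict (f (a, inv b)) (A <#> B) \<one>" using oneAB by (simp add: f_def)
      moreover have "(a, inv b) \<in> carrier D" using ab by (simp add: D_def DirProd_def)
      ultimately show "x \<in> orbit D (\<lambda>g. restrict (f g) (A <#> B)) \<one>"
        unfolding orbit_def by blast
    qed
  qed
  have "card (A <#> B) dvd order D"
    using group_action.orbit_stabilizer_theorem[OF act oneAB] orb by (metis dvd_triv_left)
  moreover have "order D = card A * card B"
    by (simp add: order_def D_def DirProd_def card_cartesian_product)
  moreover obtain i j where "card A = 2 ^ i" "card B = 2 ^ j"
    using A B by (auto simp: two_subgroup_def)
  ultimately have "card (A <#> B) dvd 2 ^ (i + j)" by (simp add: power_add)
  then show ?thesis
    using sub divides_primepow_nat[OF two_is_prime_nat] unfolding two_subgroup_def by metis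
qed

lemma (in group) two_subgroup_cyclic:
  assumes "a \<in> carrier G" "ord a = 2 ^ n"
  shows "two_subgroup G (generate G {a})"
  using generate_is_subgroup[of "{a}"] generate_pow_card[of a] assms
  unfolding two_subgroup_def by (metis empty_subsetI insert_subset)

lemma (in group) ord_two_power:
  assumes "a \<in> carrier G" "a [^] ((2::nat) ^ n) = \<one>"
  shows "\<exists>k. ord a = 2 ^ k"
  using assms pow_eq_id divides_primepow_nat[OF two_is_prime_nat] by metis

text \<open>The involution \<open>x\<close> inverts \<open>x \<otimes> y\<close>, hence normalizes
  the cyclic 2-group generated by \<open>x \<otimes> y\<close>. The product of that group with the
  one generated by \<open>x\<close> is a 2-group containing \<open>x\<close> and
  \<open>y = (y \<otimes> x) \<otimes> x\<close>.\<close>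

lemma (in group) two_subgroup_dihedral:
  assumes x: "x \<in> carrier G" "x \<otimes> x = \<one>" and y: "y \<in> carrier G" "y \<otimes> y = \<one>"
    and xy: "(x \<otimes> y) [^] ((2::nat) ^ n) = \<one>"
  shows "two_subgroup G (generate G {x, y})"
proof -
  have c: "x \<otimes> y \<in> carrier G" using x y by auto
  have ix: "inv x = x" and iy: "inv y = y" using x y inv_equality by auto
  have ixy: "inv (x \<otimes> y) = y \<otimes> x" using x y ix iy by (simp add: inv_mult_group)
  obtain k where k: "ord (x \<otimes> y) = 2 ^ k" using ord_two_power[OF c xy] by blast
  let ?A = "generate G {x \<otimes> y}" and ?B = "generate G {x}"
  have A: "two_subgroup G ?A" using two_subgroup_cyclic[OF c k] .
  have "x [^] (2::nat) = \<one>" using x by (simp add: numeral_2_eq_2)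
  then obtain j where "ord x = 2 ^ j" using ord_two_power[of x 1] x by auto
  then have B: "two_subgroup G ?B" using two_subgroup_cyclic x by blast
  have sA: "subgroup ?A G" and sB: "subgroup ?B G" using A B by (auto simp: two_subgroup_def)
  have sN: "subgroup (nrm G ?A) G" using sA subgroup.subset subgroup_nrm by blast
  have mem: "x \<otimes> y \<in> ?A" "y \<otimes> x \<in> ?A"
    using generate.incl[of "x \<otimes> y" "{x \<otimes> y}" G] generate.inv[of "x \<otimes> y" "{x \<otimes> y}" G] ixy by auto
  have "inv x \<otimes> (x \<otimes> y) \<otimes> x = y \<otimes> x" using x y by simp
  moreover have "x \<otimes> (x \<otimes> y) \<otimes> inv x = y \<otimes> x"
    using x y ix by (metis cancel_left(1))
  moreover have "x \<otimes> inv (x \<otimes> y) \<otimes> inv x = x \<otimes> y" "inv x \<otimes> inv (x \<otimes> y) \<otimes> x = x \<otimes> y"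
    using x y ix ixy by (simp_all add: m_assoc)
  \<comment> \<open>Adding the inverse to the generators makes conjugation by \<open>x\<close> a
    mere swap of the two.\<close>
  ultimately have "x \<in> nrm G {x \<otimes> y, inv (x \<otimes> y)}"
    using x y ixy by (auto simp: nrm_def)
  then have "x \<in> nrm G (generate G {x \<otimes> y, inv (x \<otimes> y)})"
    using nrm_generate[of "{x \<otimes> y, inv (x \<otimes> y)}"] c by auto
  moreover have "generate G {x \<otimes> y, inv (x \<otimes> y)} = ?A"
  proof
    show "generate G {x \<otimes> y, inv (x \<otimes> y)} \<subseteq> ?A"
      by (rule generate_subgroup_incl[OF _ sA]) (use mem ixy in auto)
    show "?A \<subseteq> generate G {x \<otimes> y, inv (x \<otimes> y)}" by (rule mono_generate) auto
  qed
  ultimately have "x \<in> nrm G ?A" by simp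
  then have "?B \<subseteq> nrm G ?A" using generate_subgroup_incl[of "{x}" "nrm G ?A"] sN by auto
  then have AB: "two_subgroup G (?A <#> ?B)" using two_subgroup_set_mult A B by blast
  then have sAB: "subgroup (?A <#> ?B) G" by (auto simp: two_subgroup_def)
  have "x \<in> ?B" by (rule generate.incl) auto
  then have "\<one> \<otimes> x \<in> ?A <#> ?B" "(y \<otimes> x) \<otimes> x \<in> ?A <#> ?B"
    using mem generate.one[of G] unfolding set_mult_def by blast+
  then have "{x, y} \<subseteq> ?A <#> ?B" using x y by (simp add: m_assoc)
  then have "generate G {x, y} \<subseteq> ?A <#> ?B" using generate_subgroup_incl sAB by blast
  then show ?thesis using two_subgroup_mono[OF AB generate_is_subgroup] x y by simp
qed

section \<open>Baer's theorem for involutions\<close>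

lemma (in group) pow_conjugate:
  assumes "g \<in> carrier G" "a \<in> carrier G"
  shows "(g \<otimes> a \<otimes> inv g) [^] (n::nat) = g \<otimes> a [^] n \<otimes> inv g"
  using assms by (induct n) (simp_all add: m_assoc)

text \<open>Consider the sets of conjugates of \<open>s\<close> that generate a 2-subgroup.
  Singletons are such sets, so once the maximal one is unique it is the whole class
  \<open>C\<close>. If \<open>S\<close> and \<open>T\<close> were distinct and maximal, elements
  \<open>x\<close> of \<open>S - T\<close> and \<open>y\<close> of \<open>T - S\<close> normalizing
  \<open>S \<inter> T\<close> would generate a dihedral 2-group; adjoining both to
  \<open>S \<inter> T\<close> still generates a 2-group, so some maximal set meets both
  \<open>S\<close> and \<open>T\<close> in more.\<close>

theorem (in group) baer_involution:
  assumes fin: "finite (carrier G)" and s: "s \<in> carrier G" "s \<otimes> s = \<one>"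
    and pow: "\<And>g. g \<in> carrier G \<Longrightarrow> \<exists>n. (s \<otimes> (g \<otimes> s \<otimes> inv g)) [^] ((2::nat) ^ n) = \<one>"
  shows "\<exists>N. N \<lhd> G \<and> two_subgroup G N \<and> s \<in> N"
proof -
  define C where "C = (\<lambda>g. g \<otimes> s \<otimes> inv g) ` carrier G"
  have Cc: "C \<subseteq> carrier G" using s by (auto simp: C_def)
  have finC: "finite C" using fin by (simp add: C_def)
  have conjC: "g \<otimes> x \<otimes> inv g \<in> C" if g: "g \<in> carrier G" and x: "x \<in> C" for g x
  proof -
    obtain h where h: "h \<in> carrier G" "x = h \<otimes> s \<otimes> inv h" using x by (auto simp: C_def)
    then have "g \<otimes> x \<otimes> inv g = (g \<otimes> h) \<otimes> s \<otimes> inv (g \<otimes> h)"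
      using g s by (simp add: m_assoc inv_mult_group)
    then show ?thesis using g h by (simp add: C_def)
  qed
  have sC: "s \<in> C" using s unfolding C_def by (intro image_eqI[of _ _ \<one>]) auto
  have invC: "x \<otimes> x = \<one>" if x: "x \<in> C" for x
  proof -
    obtain h where h: "h \<in> carrier G" "x = h \<otimes> s \<otimes> inv h" using x by (auto simp: C_def)
    then have "x \<otimes> x = h \<otimes> (s \<otimes> s) \<otimes> inv h" using s(1) by (simp add: m_assoc)
    then show ?thesis using s h by simp
  qed
  have powC: "\<exists>n. (x \<otimes> y) [^] ((2::nat) ^ n) = \<one>" if xy: "x \<in> C" "y \<in> C" for x y
  proof -
    obtain g h where gh: "g \<in> carrier G" "x = g \<otimes> s \<otimes> inv g" "h \<in> carrier G" "y = h \<otimes> s \<otimes> inv h"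
      using xy by (auto simp: C_def)
    \<comment> \<open>Conjugating by \<open>inv g\<close> reduces the product of two conjugates to
      \<open>s\<close> times one conjugate, as in \<open>pow\<close>.\<close>
    define k where "k = inv g \<otimes> h"
    have k: "k \<in> carrier G" using gh by (simp add: k_def)
    have "x \<otimes> y = g \<otimes> (s \<otimes> (k \<otimes> s \<otimes> inv k)) \<otimes> inv g"
      using gh s(1) by (simp add: k_def m_assoc inv_mult_group)
    moreover obtain n where "(s \<otimes> (k \<otimes> s \<otimes> inv k)) [^] ((2::nat) ^ n) = \<one>"
      using pow[OF k] by blast
    ultimately show ?thesis using gh s(1) k pow_conjugate by (intro exI[of _ n]) simp
  qed
  define F where "F = {D. D \<subseteq> C \<and> two_subgroup G (generate G D)}"
  define Mx where "Mx = (\<lambda>D. D \<in> F \<and> (\<forall>D'\<in>F. D \<subseteq> D' \<longrightarrow> D = D'))"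
  have finF: "finite F" using finC by (auto simp: F_def intro: finite_subset[of _ "Pow C"])
  have ext: "\<exists>D'. Mx D' \<and> D \<subseteq> D'" if "D \<in> F" for D
    using finite_has_maximal2[OF finF that] by (auto simp: Mx_def)
  have gsub: "subgroup (generate G D) G" if "D \<subseteq> C" for D
    using that Cc generate_is_subgroup by blast
  have ginc: "D \<subseteq> generate G D" for D by (rule subsetI) (rule generate.incl)
  have closed: "generate G D \<inter> C = D" if D: "Mx D" for D
  proof -
    have DC: "D \<subseteq> C" and t: "two_subgroup G (generate G D)" using D by (auto simp: Mx_def F_def)
    let ?D = "generate G D \<inter> C"
    have "generate G ?D \<subseteq> generate G D"
      by (rule generate_subgroup_incl[OF _ gsub[OF DC]]) auto
    then have "?D \<in> F" using two_subgroup_mono[OF t gsub] by (auto simp: F_def)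
    then show ?thesis using D ginc[of D] DC by (auto simp: Mx_def)
  qed
  \<comment> \<open>Enlarge \<open>\<langle>S \<inter> T\<rangle>\<close> to a subgroup of \<open>\<langle>S\<rangle>\<close> maximal with the same trace on \<open>C\<close>:
    its normalizer in \<open>\<langle>S\<rangle>\<close> contains a further element of \<open>C\<close>.\<close>
  have key: "\<exists>x\<in>S - T. x \<in> nrm G (S \<inter> T)" if S: "Mx S" and T: "Mx T" and ne: "S \<noteq> T" for S T
  proof -
    let ?Y = "S \<inter> T" and ?S = "generate G S"
    have SC: "S \<subseteq> C" and tS: "two_subgroup G ?S" and TF: "T \<in> F" and TC: "T \<subseteq> C"
      using S T by (auto simp: Mx_def F_def)
    have neY: "?Y \<noteq> S" using S TF ne by (auto simp: Mx_def)
    define P where "P = {M. subgroup M G \<and> M \<subseteq> ?S \<and> M \<inter> C = ?Y}"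
    have "generate G ?Y \<inter> C \<subseteq> ?Y"
      using mono_generate[of ?Y S] mono_generate[of ?Y T] closed[OF S] closed[OF T] by blast
    then have "generate G ?Y \<inter> C = ?Y" using ginc[of ?Y] SC by blast
    then have "generate G ?Y \<in> P"
      using gsub[of ?Y] SC mono_generate[of ?Y S] by (auto simp: P_def)
    moreover have "finite P"
      by (rule finite_subset[of _ "Pow ?S"]) (use two_subgroup_finite[OF tS] in \<open>auto simp: P_def\<close>)
    ultimately obtain M where M: "M \<in> P" and maxM: "\<And>M'. M' \<in> P \<Longrightarrow> M \<subseteq> M' \<Longrightarrow> M = M'"
      using finite_has_maximal by (metis empty_iff)
    have sM: "subgroup M G" and MS: "M \<subseteq> ?S" and MC: "M \<inter> C = ?Y" using M by (auto simp: P_def)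
    have "M \<noteq> ?S" using MC closed[OF S] neY by auto
    then obtain a where a: "a \<in> ?S - M" "a \<in> nrm G M"
      using two_subgroup_normalizer_grows[OF tS sM] MS by auto
    define N where "N = nrm G M \<inter> ?S"
    have sN: "subgroup N G"
      unfolding N_def using subgroup_nrm[OF subgroup.subset[OF sM]] gsub[OF SC] subgroups_Inter_pair by blast
    have MN: "M \<subseteq> N" using subgroup_le_nrm[OF sM] MS by (auto simp: N_def)
    have "N \<notin> P" using maxM[of N] MN a by (auto simp: N_def)
    then have "N \<inter> C \<noteq> ?Y" using sN by (auto simp: P_def N_def)
    then obtain x where x: "x \<in> N" "x \<in> C" "x \<notin> ?Y" using MN MC by blast
    have xS: "x \<in> S" using x closed[OF S] by (auto simp: N_def)
    have xc: "x \<in> carrier G" using x Cc by auto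
    have "x \<otimes> h \<otimes> inv x \<in> ?Y \<and> inv x \<otimes> h \<otimes> x \<in> ?Y" if h: "h \<in> ?Y" for h
    proof -
      have hM: "h \<in> M" and hC: "h \<in> C" using h MC by auto
      have "x \<otimes> h \<otimes> inv x \<in> M" "inv x \<otimes> h \<otimes> x \<in> M"
        using x hM by (auto simp: N_def nrm_def)
      moreover have "x \<otimes> h \<otimes> inv x \<in> C" "inv x \<otimes> h \<otimes> x \<in> C"
        using conjC[OF xc hC] conjC[OF inv_closed[OF xc] hC] xc by simp_all
      ultimately show ?thesis using MC by blast
    qed
    then have "x \<in> nrm G ?Y" using xc by (simp add: nrm_def)
    then show ?thesis using x xS by auto
  qed
  \<comment> \<open>Induction downward on the size of the intersection.\<close>
  have uniq: "S = T" if "Mx S" "Mx T" for S T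
    using that
  proof (induction "card C - card (S \<inter> T)" arbitrary: S T rule: less_induct)
    case less
    show ?case
    proof (rule ccontr)
      assume ne: "S \<noteq> T"
      let ?Y = "S \<inter> T"
      have SC: "S \<subseteq> C" and TC: "T \<subseteq> C" and tS: "two_subgroup G (generate G S)"
        using less.prems by (auto simp: Mx_def F_def)
      obtain x where x: "x \<in> S" "x \<notin> T" "x \<in> nrm G ?Y" using key[OF less.prems ne] by auto
      obtain y where y: "y \<in> T" "y \<notin> S" "y \<in> nrm G ?Y"
        using key[OF less.prems(2,1)] ne by (auto simp: Int_commute)
      have YC: "?Y \<subseteq> C" using SC by auto
      have Yc: "?Y \<subseteq> carrier G" using YC Cc by auto
      have xy: "x \<in> C" "y \<in> C" using x y SC TC by auto
      have tY: "two_subgroup G (generate G ?Y)"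
        using two_subgroup_mono[OF tS gsub[OF YC]] mono_generate[of ?Y S] by auto
      obtain n where "(x \<otimes> y) [^] ((2::nat) ^ n) = \<one>" using powC xy by blast
      then have tD: "two_subgroup G (generate G {x, y})"
        using two_subgroup_dihedral[of x y n] xy Cc invC by auto
      have "subgroup (nrm G (generate G ?Y)) G"
        using subgroup_nrm subgroup.subset[OF gsub[OF YC]] by blast
      moreover have "{x, y} \<subseteq> nrm G (generate G ?Y)" using nrm_generate[OF Yc] x y by auto
      ultimately have "generate G {x, y} \<subseteq> nrm G (generate G ?Y)"
        using generate_subgroup_incl by blast
      then have tU: "two_subgroup G (generate G ?Y <#> generate G {x, y})"
        using two_subgroup_set_mult tY tD by blast
      then have sU: "subgroup (generate G ?Y <#> generate G {x, y}) G"
        by (simp add: two_subgroup_def)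
      have gY: "generate G ?Y \<subseteq> carrier G" "generate G {x, y} \<subseteq> carrier G"
        using tY tD subgroup.subset by (auto simp: two_subgroup_def)
      have Y1: "h \<otimes> \<one> \<in> generate G ?Y <#> generate G {x, y}" if "h \<in> ?Y" for h
        unfolding set_mult_def using that ginc[of ?Y] generate.one[of G "{x, y}"] by blast
      have "?Y \<subseteq> generate G ?Y <#> generate G {x, y}"
      proof
        fix h assume h: "h \<in> ?Y"
        then have "h \<otimes> \<one> = h" using Yc by (intro r_one) blast
        then show "h \<in> generate G ?Y <#> generate G {x, y}" using Y1[OF h] by simp
      qed
      moreover have "\<one> \<otimes> h \<in> generate G ?Y <#> generate G {x, y}" if "h \<in> {x, y}" for h
        unfolding set_mult_def using that ginc[of "{x, y}"] generate.one[of G ?Y] by blast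
      then have "{x, y} \<subseteq> generate G ?Y <#> generate G {x, y}" using xy Cc by fastforce
      ultimately have "generate G (insert x (insert y ?Y)) \<subseteq> generate G ?Y <#> generate G {x, y}"
        by (intro generate_subgroup_incl[OF _ sU]) auto
      moreover have iC: "insert x (insert y ?Y) \<subseteq> C" using xy YC by auto
      ultimately have "insert x (insert y ?Y) \<in> F"
        using two_subgroup_mono[OF tU gsub[OF iC]] by (simp add: F_def)
      \<comment> \<open>\<open>U\<close> shares \<open>x\<close> with \<open>S\<close> and
        \<open>y\<close> with \<open>T\<close> beyond \<open>S \<inter> T\<close>, so the induction
        hypothesis identifies it with both.\<close>
      then obtain U where U: "Mx U" "insert x (insert y ?Y) \<subseteq> U" using ext by blast
      have "card ?Y < card (S \<inter> U)"
        by (rule psubset_card_mono) (use x U SC finC in \<open>auto intro: finite_subset\<close>)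
      moreover have "card (S \<inter> U) \<le> card C" using SC finC by (intro card_mono) auto
      ultimately have "card C - card (S \<inter> U) < card C - card ?Y" by arith
      then have "S = U" using less.hyps less.prems U by blast
      moreover have "card ?Y < card (U \<inter> T)"
        by (rule psubset_card_mono) (use y U TC finC in \<open>auto intro: finite_subset\<close>)
      moreover have "card (U \<inter> T) \<le> card C" using TC finC by (intro card_mono) auto
      ultimately have "card C - card (U \<inter> T) < card C - card ?Y" by arith
      then have "U = T" using less.hyps less.prems U by blast
      then show False using \<open>S = U\<close> ne by simp
    qed
  qed
  have sing: "{x} \<in> F" if x: "x \<in> C" for x
  proof -
    have xc: "x \<in> carrier G" using x Cc by auto
    have "x [^] ((2::nat) ^ 1) = \<one>" using invC[OF x] xc by (simp add: numeral_2_eq_2)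
    then obtain k where "ord x = 2 ^ k" using ord_two_power[OF xc] by blast
    then show ?thesis using two_subgroup_cyclic[OF xc] x by (simp add: F_def)
  qed
  obtain D where D: "Mx D" using ext[OF sing[OF sC]] by blast
  have "C \<subseteq> D"
  proof
    fix x assume "x \<in> C"
    then obtain D' where "Mx D'" "{x} \<subseteq> D'" using ext sing by blast
    then show "x \<in> D" using uniq D by blast
  qed
  then have "two_subgroup G (generate G C)" using D by (auto simp: Mx_def F_def)
  moreover have "generate G C \<lhd> G" using normal_generateI[OF Cc] conjC by blast
  ultimately show ?thesis using sC ginc by blast
qed

section \<open>Commutative automorphic loops of exponent 2\<close>

lemma (in group) commute_mult:
  assumes "g \<in> carrier G" "a \<in> carrier G" "b \<in> carrier G" "g \<otimes> a = a \<otimes> g" "g \<otimes> b = b \<otimes> g"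
  shows "g \<otimes> (a \<otimes> b) = (a \<otimes> b) \<otimes> g"
  using assms by (metis m_assoc)

lemma (in group) commute_inv:
  assumes "g \<in> carrier G" "a \<in> carrier G" "g \<otimes> a = a \<otimes> g"
  shows "g \<otimes> inv a = inv a \<otimes> g"
  using assms by (metis inv_closed inv_solve_left inv_solve_right m_assoc m_closed)

text \<open>The group stays abstract while its elements are applied as functions, so that the same
  facts serve \<open>BijGroup Q\<close> and its subgroup \<open>Mlt Q m\<close>.\<close>

locale perm_group = group G for G :: "('a \<Rightarrow> 'a, 'b) monoid_scheme" (structure) +
  fixes Q :: "'a set"
  assumes act_closed [simp]: "\<lbrakk>g \<in> carrier G; x \<in> Q\<rbrakk> \<Longrightarrow> g x \<in> Q"
    and act_mult [simp]: "\<lbrakk>g \<in> carrier G; h \<in> carrier G; x \<in> Q\<rbrakk> \<Longrightarrow> (g \<otimes> h) x = g (h x)"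
    and act_one [simp]: "x \<in> Q \<Longrightarrow> \<one> x = x"
    and act_ext: "\<lbrakk>g \<in> carrier G; h \<in> carrier G; \<And>x. x \<in> Q \<Longrightarrow> g x = h x\<rbrakk> \<Longrightarrow> g = h"
begin

lemma act_inv [simp]:
  assumes "g \<in> carrier G" "x \<in> Q"
  shows "(inv g) (g x) = x" "g ((inv g) x) = x"
  using act_mult[of "inv g" g x] act_mult[of g "inv g" x] assms by simp_all

lemma act_inv_fix: "\<lbrakk>g \<in> carrier G; x \<in> Q; g x = x\<rbrakk> \<Longrightarrow> (inv g) x = x"
  using act_inv(1)[of g x] by simp

lemma act_inj: "\<lbrakk>g \<in> carrier G; x \<in> Q; y \<in> Q; g x = g y\<rbrakk> \<Longrightarrow> x = y"
  by (metis act_inv(1))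

lemma act_eqI: "\<lbrakk>g \<otimes> h = k; g \<in> carrier G; h \<in> carrier G; x \<in> Q\<rbrakk> \<Longrightarrow> g (h x) = k x"
  using act_mult by fastforce

text \<open>The square of \<open>g\<close> fixes \<open>w\<close>, hence so does the even power
  \<open>g [^] (k - 1)\<close>; the remaining factor of \<open>g [^] k = \<one>\<close> must then
  fix \<open>w\<close> too.\<close>

lemma odd_power_fix:
  assumes g: "g \<in> carrier G" and w: "w \<in> Q" and k: "odd (k::nat)" "g [^] k = \<one>" and fix2: "g (g w) = w"
  shows "g w = w"
proof -
  have *: "(g [^] (2 * j)) w = w" for j :: nat
    by (induct j) (use g w fix2 in simp_all)
  obtain j where j: "k = Suc (2 * j)" using k by (auto elim: oddE)
  have "g ((g [^] (2 * j)) w) = (g \<otimes> g [^] (2 * j)) w" using g w by simp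
  also have "g \<otimes> g [^] (2 * j) = \<one>" using k(2) g nat_pow_Suc2[of g "2 * j"] unfolding j by simp
  finally show ?thesis using * w by simp
qed

end

text \<open>The translations \<open>L x\<close> serve as the multiplication: \<open>L x y\<close> is the product of \<open>x\<close> and \<open>y\<close>.\<close>

locale exponent_two_loop = perm_group G Q for G :: "('a \<Rightarrow> 'a, 'b) monoid_scheme" (structure) and Q +
  fixes L :: "'a \<Rightarrow> 'a \<Rightarrow> 'a" and e :: 'a
  assumes e [simp]: "e \<in> Q"
    and L_closed [simp]: "x \<in> Q \<Longrightarrow> L x \<in> carrier G"
    and L_comm: "\<lbrakk>x \<in> Q; y \<in> Q\<rbrakk> \<Longrightarrow> L x y = L y x"
    and L_e [simp]: "x \<in> Q \<Longrightarrow> L e x = x"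
    and L_self [simp]: "x \<in> Q \<Longrightarrow> L x x = e"
    and L_aut: "\<lbrakk>\<phi> \<in> carrier G; \<phi> e = e; x \<in> Q; y \<in> Q\<rbrakk> \<Longrightarrow> \<phi> (L x y) = L (\<phi> x) (\<phi> y)"
begin

section \<open>Inner mappings and commutators of translations\<close>

lemma L_right_e [simp]: "x \<in> Q \<Longrightarrow> L x e = x"
  using L_comm[of x e] by simp

lemma L_inv_e [simp]: "x \<in> Q \<Longrightarrow> (inv (L x)) e = x"
  using act_inv(1)[of "L x" x] by simp

lemma L_inv_self [simp]: "x \<in> Q \<Longrightarrow> (inv (L x)) x = e"
  using act_inv(1)[of "L x" e] by simp

text \<open>The stabilizer of \<open>e\<close>, in the role of the inner mapping group;
  \<open>L_aut\<close> makes its elements automorphisms.\<close>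

definition H where "H = {\<phi> \<in> carrier G. \<phi> e = e}"

lemma H_carrier [simp]: "\<phi> \<in> H \<Longrightarrow> \<phi> \<in> carrier G"
  and H_e [simp]: "\<phi> \<in> H \<Longrightarrow> \<phi> e = e"
  by (auto simp: H_def)

lemma H_I: "\<lbrakk>\<phi> \<in> carrier G; \<phi> e = e\<rbrakk> \<Longrightarrow> \<phi> \<in> H"
  unfolding H_def by blast

lemma H_mult [simp]: "\<lbrakk>\<phi> \<in> H; \<psi> \<in> H\<rbrakk> \<Longrightarrow> \<phi> \<otimes> \<psi> \<in> H"
  and H_inv [simp]: "\<phi> \<in> H \<Longrightarrow> inv \<phi> \<in> H"
  and H_one [simp]: "\<one> \<in> H"
  by (auto intro!: H_I intro: act_inv_fix)

lemma H_L: "\<lbrakk>\<phi> \<in> H; x \<in> Q\<rbrakk> \<Longrightarrow> \<phi> \<otimes> L x = L (\<phi> x) \<otimes> \<phi>"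
  by (rule act_ext) (simp_all add: L_aut)

lemma H_L_commute: "\<lbrakk>\<phi> \<in> H; x \<in> Q; \<phi> x = x\<rbrakk> \<Longrightarrow> \<phi> \<otimes> L x = L x \<otimes> \<phi>"
  using H_L by metis

lemma factor_unique:
  assumes "L p \<otimes> \<phi> = L q \<otimes> \<psi>" "\<phi> \<in> H" "\<psi> \<in> H" "p \<in> Q" "q \<in> Q"
  shows "p = q" "\<phi> = \<psi>"
proof -
  have "(L p \<otimes> \<phi>) e = (L q \<otimes> \<psi>) e" using assms(1) by simp
  then show "p = q" using assms(2-5) by simp
  then show "\<phi> = \<psi>" using assms by simp
qed

text \<open>Both \<open>L x \<otimes> inv (L y)\<close> and \<open>L (L x y)\<close> interchange
  \<open>e\<close> and \<open>L x y\<close>. They differ by an element of \<open>H\<close> fixing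
  \<open>L x y\<close>, and such an element commutes with \<open>L (L x y)\<close>.\<close>

lemma commute_quotient:
  assumes x: "x \<in> Q" and y: "y \<in> Q"
  shows "L (L x y) \<otimes> (L x \<otimes> inv (L y)) = (L x \<otimes> inv (L y)) \<otimes> L (L x y)"
proof -
  let ?u = "L x y" and ?g = "L x \<otimes> inv (L y)"
  define \<kappa> where "\<kappa> = inv (L ?u) \<otimes> ?g"
  have u: "?u \<in> Q" using x y by simp
  have "(inv (L y)) ?u = x" using L_comm[of x y] x y by simp
  then have gu: "?g ?u = e" using x y by simp
  have ge: "?g e = ?u" using x y by simp
  have "\<kappa> z = (inv (L ?u)) (?g z)" if "z \<in> Q" for z
    unfolding \<kappa>_def by (rule act_mult) (use that x y in simp_all)
  then have \<kappa>e: "\<kappa> e = e" and \<kappa>u: "\<kappa> ?u = ?u" using u ge gu by simp_all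
  have "\<kappa> \<in> carrier G" using x y by (simp add: \<kappa>_def)
  then have \<kappa>: "\<kappa> \<in> H" "\<kappa> ?u = ?u" using \<kappa>e \<kappa>u by (simp_all add: H_I)
  have "?g = L ?u \<otimes> \<kappa>" using x y by (simp add: \<kappa>_def)
  then show ?thesis using commute_mult[of "L ?u" "L ?u" \<kappa>] H_L_commute[OF \<kappa>(1) u \<kappa>(2)] \<kappa>(1) u by simp
qed

definition c where "c x y = inv (L x) \<otimes> inv (L y) \<otimes> L x \<otimes> L y"

lemma c_H [simp]: "\<lbrakk>x \<in> Q; y \<in> Q\<rbrakk> \<Longrightarrow> c x y \<in> H"
  unfolding c_def using L_comm[of x y] by (intro H_I) simp_all

text \<open>The inner mapping that measures how far \<open>L\<close> is from a homomorphism; by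
  commutativity it fixes its first argument and thus commutes with \<open>L x\<close>.\<close>

definition h where "h x y = inv (L (L x y)) \<otimes> L x \<otimes> L y"

lemma h_H [simp]: "\<lbrakk>x \<in> Q; y \<in> Q\<rbrakk> \<Longrightarrow> h x y \<in> H"
  unfolding h_def by (intro H_I) simp_all

lemma h_fix [simp]:
  assumes "x \<in> Q" "y \<in> Q"
  shows "h x y x = x"
proof -
  have "L x (L y x) = L (L x y) x" using assms L_comm by (metis act_closed L_closed)
  then show ?thesis using assms by (simp add: h_def)
qed

lemma L_mult: "\<lbrakk>x \<in> Q; y \<in> Q\<rbrakk> \<Longrightarrow> L x \<otimes> L y = L (L x y) \<otimes> h x y"
  by (simp add: h_def m_assoc)

text \<open>Substituting \<open>L (L x y) = L y \<otimes> L x \<otimes> inv k\<close> into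
  \<open>commute_quotient\<close> leaves
  \<open>L ((inv k) x) = c x y \<otimes> L x \<otimes> c x y\<close>. Moving the first commutator to
  the right gives a translation times the square of \<open>c x y\<close>, and
  \<open>factor_unique\<close> makes that square trivial.\<close>

lemma c_square:
  assumes x: "x \<in> Q" and y: "y \<in> Q"
  shows "c x y \<otimes> c x y = \<one>"
proof -
  define k where "k = h y x"
  let ?k = "inv k" and ?u = "L x y" and ?c = "c x y"
  have u: "L y x = ?u" "?u \<in> Q" using L_comm[OF y x] x y by simp_all
  have k: "k \<in> H" "k y = y" using x y by (simp_all add: k_def)
  have kc: "k \<in> carrier G" using k by simp
  have Lu: "L ?u = L y \<otimes> L x \<otimes> ?k" using L_mult[OF y x] x y kc u by (simp add: k_def m_assoc)
  have "L y \<otimes> L x \<otimes> ?k \<otimes> (L x \<otimes> inv (L y)) = (L x \<otimes> inv (L y)) \<otimes> (L y \<otimes> L x \<otimes> ?k)"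
    using commute_quotient[OF x y] Lu by simp
  then have "L y \<otimes> (L x \<otimes> (?k \<otimes> (L x \<otimes> inv (L y)))) = L x \<otimes> (L x \<otimes> ?k)"
    using x y kc by (simp add: m_assoc)
  then have "?k \<otimes> (L x \<otimes> inv (L y)) = inv (L x) \<otimes> (inv (L y) \<otimes> (L x \<otimes> (L x \<otimes> ?k)))"
    using x y kc by (metis cancel_left(2) inv_closed m_closed L_closed)
  then have "?k \<otimes> L x \<otimes> inv (L y) \<otimes> k = inv (L x) \<otimes> (inv (L y) \<otimes> (L x \<otimes> L x))"
    using x y kc by (simp add: m_assoc)
  moreover have "inv (L y) \<otimes> k = k \<otimes> inv (L y)"
    using commute_inv[OF kc L_closed[OF y]] H_L_commute[OF k(1) y k(2)] by simp
  moreover have "?k \<otimes> L x \<otimes> k = L (?k x)"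
    using H_L[of ?k x] k x kc by (simp add: m_assoc)
  ultimately have "L (?k x) \<otimes> inv (L y) = inv (L x) \<otimes> (inv (L y) \<otimes> (L x \<otimes> L x))"
    using x y kc by (metis m_assoc inv_closed m_closed L_closed)
  then have "L (?k x) \<otimes> inv (L y) \<otimes> L y = inv (L x) \<otimes> (inv (L y) \<otimes> (L x \<otimes> L x)) \<otimes> L y"
    by simp
  then have "L (?k x) = ?c \<otimes> L x \<otimes> ?c"
    using x y kc by (simp add: c_def m_assoc)
  also have "\<dots> = L (?c x) \<otimes> (?c \<otimes> ?c)"
    using H_L[of ?c x] x y by (simp add: m_assoc)
  finally have eq: "L (?k x) = L (?c x) \<otimes> (?c \<otimes> ?c)" .
  have "L (?k x) \<otimes> \<one> = L (?k x)" using x kc by simp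
  then have "L (?k x) \<otimes> \<one> = L (?c x) \<otimes> (?c \<otimes> ?c)" using eq by (rule trans)
  then show ?thesis using factor_unique(2)[of "?k x" \<one> "?c x" "?c \<otimes> ?c"] x y kc by simp
qed

lemma c_inv [simp]: "\<lbrakk>x \<in> Q; y \<in> Q\<rbrakk> \<Longrightarrow> inv (c x y) = c x y"
  by (simp add: c_square inv_equality)

lemma c_cancel [simp]:
  "\<lbrakk>x \<in> Q; y \<in> Q; g \<in> carrier G\<rbrakk> \<Longrightarrow> c x y \<otimes> (c x y \<otimes> g) = g"
  "\<lbrakk>x \<in> Q; y \<in> Q; z \<in> Q\<rbrakk> \<Longrightarrow> c x y (c x y z) = z"
  using cancel_left(1)[of "c x y" g] act_inv(1)[of "c x y" z] by simp_all

lemma c_swap: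
  assumes "x \<in> Q" "y \<in> Q"
  shows "L y \<otimes> L x = L x \<otimes> L y \<otimes> c x y"
proof -
  have "L x \<otimes> L y \<otimes> inv (c x y) = L y \<otimes> L x"
    using assms by (simp add: c_def inv_mult_group m_assoc del: c_inv)
  then show ?thesis using assms by simp
qed

lemma conj_L: "\<lbrakk>x \<in> Q; y \<in> Q\<rbrakk> \<Longrightarrow> inv (L x) \<otimes> L y \<otimes> L x = L y \<otimes> c x y"
  using c_swap[of x y] by (simp add: m_assoc)

text \<open>In an elementary abelian 2-group \<open>e\<close> is the sum of \<open>a\<close>,
  \<open>r\<close> and \<open>L a r\<close>, so an affine map fixing these three fixes
  \<open>e\<close>. Here the conjugate of \<open>\<Lambda>\<close> by \<open>L a\<close> is an inner
  mapping that fixes \<open>r\<close> and the solution \<open>w\<close> of \<open>L a w = r\<close>,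
  hence also \<open>a\<close>.\<close>

lemma affine_fix:
  assumes \<Lambda>: "\<Lambda> \<in> carrier G" and a: "a \<in> Q" "\<Lambda> a = a" and r: "r \<in> Q" "\<Lambda> r = r"
    and ar: "\<Lambda> (L a r) = L a r"
  shows "\<Lambda> e = e"
proof -
  define \<mu> where "\<mu> = inv (L a) \<otimes> \<Lambda> \<otimes> L a"
  have \<mu>: "\<mu> \<in> H" using \<Lambda> a by (intro H_I) (simp_all add: \<mu>_def)
  have \<mu>r: "\<mu> r = r" using \<Lambda> a r ar by (simp add: \<mu>_def)
  define w where "w = (inv (L a)) r"
  have w: "w \<in> Q" "L a w = r" using a r by (simp_all add: w_def)
  have \<mu>w: "\<mu> w = w" using \<Lambda> a r w by (simp add: \<mu>_def) (simp add: w_def)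
  have "L (\<mu> a) w = L a w" using L_aut[of \<mu> a w] \<mu> \<mu>r \<mu>w w a by simp
  then have "L w (\<mu> a) = L w a" using L_comm \<mu> a w by simp
  then have "\<mu> a = a" using act_inj[of "L w" "\<mu> a" a] \<mu> a w by simp
  moreover have "L a (\<mu> a) = \<Lambda> e" using \<Lambda> a by (simp add: \<mu>_def)
  ultimately show ?thesis using a by simp
qed

section \<open>The exchange identity and the existence of an involutory translation\<close>

lemma double_translate:
  assumes v: "v \<in> Q" and y: "y \<in> Q"
  shows "L (L v y) \<otimes> L v = L v \<otimes> L v \<otimes> L y \<otimes> inv (h y v)"
proof -
  define k where "k = h v y"
  let ?c = "c v y" and ?u = "L v y"
  have u: "L y v = ?u" using L_comm[OF y v] by simp
  have k: "k \<in> H" "k v = v" using v y by (simp_all add: k_def)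
  have kc: "k \<in> carrier G" using k by simp
  have Lu: "L ?u = L v \<otimes> L y \<otimes> inv k" using L_mult[OF v y] v y kc by (simp add: k_def m_assoc)
  have "L ?u \<otimes> h y v = L ?u \<otimes> (k \<otimes> ?c)"
    using L_mult[OF y v] L_mult[OF v y] c_swap[OF v y] u v y by (simp add: k_def m_assoc)
  then have hy: "h y v = k \<otimes> ?c" using v y kc by simp
  have ih: "inv (h y v) = ?c \<otimes> inv k" using kc v y by (simp add: hy inv_mult_group)
  have "inv k \<otimes> L v = L v \<otimes> inv k"
    using H_L_commute[of "inv k" v] k v act_inv_fix by simp
  then have "L ?u \<otimes> L v = L v \<otimes> (L y \<otimes> L v) \<otimes> inv k"
    using Lu v y kc by (simp add: m_assoc)
  also have "\<dots> = L v \<otimes> L v \<otimes> L y \<otimes> inv (h y v)"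
    using v y kc by (simp add: c_swap[OF v y] ih m_assoc)
  finally show ?thesis .
qed

text \<open>By \<open>double_translate\<close>, applying \<open>L v\<close> twice to the left side
  gives the product of \<open>L v y\<close> and \<open>L v z\<close>, which is symmetric in
  \<open>y\<close> and \<open>z\<close>.\<close>

lemma exchange:
  assumes v: "v \<in> Q" and y: "y \<in> Q" and z: "z \<in> Q"
  shows "L y ((inv (h y v)) z) = L z ((inv (h z v)) y)"
proof -
  have *: "L (L v y) (L v z) = L v (L v (L y ((inv (h y v)) z)))" if "y \<in> Q" "z \<in> Q" for y z
    using act_eqI[OF double_translate[OF v that(1)], of z] v that by simp
  have "L (L v y) (L v z) = L (L v z) (L v y)" using L_comm v y z by simp
  then have "L v (L v (L y ((inv (h y v)) z))) = L v (L v (L z ((inv (h z v)) y)))"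
    using * v y z by simp
  then show ?thesis using v y z act_inj[of "L v"] by simp
qed

text \<open>The involution is \<open>T = [L a, S]\<close> with \<open>S\<close> the square of \<open>L x\<close>. With \<open>p = T e\<close>, the defect
  \<open>\<theta>\<close> in \<open>L p = T \<theta>\<close> is an inner mapping; it equals \<open>h y p\<close> for \<open>y = a, r, x\<close> where \<open>a r = x\<close>,
  so \<open>exchange\<close> together with \<open>affine_fix\<close> forces \<open>\<theta> = \<one>\<close>.\<close>

lemma ex_involution_of_moved:
  assumes x: "x \<in> Q" and a: "a \<in> Q" and moved: "L x (L x a) \<noteq> a"
  shows "\<exists>v\<in>Q. v \<noteq> e \<and> L v \<otimes> L v = \<one>"
proof -
  define S where "S = L x \<otimes> L x"
  have S: "S \<in> H" unfolding S_def by (rule H_I) (use x in simp_all)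
  have Sc: "S \<in> carrier G" using S by simp
  \<comment> \<open>Conjugating \<open>L a\<close> and \<open>L r\<close> by \<open>S\<close> gives
    the translations \<open>L b\<close> and \<open>L d\<close>, since \<open>S\<close> fixes
    \<open>e\<close>. The point \<open>r\<close> satisfies \<open>L a r = x\<close>, as
    \<open>commute_quotient\<close> needs.\<close>
  define b where "b = (inv S) a"
  define r where "r = (inv (L a)) x"
  define d where "d = (inv S) r"
  define k where "k = c x a"
  define x' where "x' = k x"
  define T where "T = inv (L a) \<otimes> L b"
  have r: "r \<in> Q" "L a r = x" using a x by (simp_all add: r_def)
  have b: "b \<in> Q" and d: "d \<in> Q" using Sc a r by (simp_all add: b_def d_def)
  have k: "k \<in> H" "inv k = k" "k \<otimes> k = \<one>" using x a by (simp_all add: k_def c_square)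
  have kc: "k \<in> carrier G" using k by simp
  have kk: "k \<otimes> (k \<otimes> g) = g" if "g \<in> carrier G" for g using that x a by (simp add: k_def)
  have x': "x' \<in> Q" using kc x by (simp add: x'_def)
  have Tc: "T \<in> carrier G" using a b by (simp add: T_def)
  note cl = x a b d r x' kc Tc Sc
  have Lb: "L b = inv S \<otimes> L a \<otimes> S"
    using H_L[of "inv S" a] S cl by (simp add: b_def m_assoc)
  have Ld: "L d = inv S \<otimes> L r \<otimes> S"
    using H_L[of "inv S" r] S cl by (simp add: d_def m_assoc)
  have conj1: "inv (L x) \<otimes> L a \<otimes> L x = L a \<otimes> k" using conj_L[OF x a] by (simp add: k_def)
  \<comment> \<open>Passing \<open>L a\<close> through the two factors \<open>L x\<close> of
    \<open>S\<close> one at a time shows \<open>T\<close> as \<open>k\<close> times a conjugate of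
    \<open>k\<close>.\<close>
  have T1: "T = k \<otimes> inv (L x) \<otimes> k \<otimes> L x"
  proof -
    have "L b = inv (L x) \<otimes> (inv (L x) \<otimes> L a \<otimes> L x) \<otimes> L x"
      using cl by (simp add: Lb S_def inv_mult_group m_assoc)
    also have "\<dots> = (inv (L x) \<otimes> L a \<otimes> L x) \<otimes> inv (L x) \<otimes> k \<otimes> L x"
      using cl by (simp only: conj1) (simp add: m_assoc conj1[symmetric])
    also have "\<dots> = L a \<otimes> (k \<otimes> inv (L x) \<otimes> k \<otimes> L x)"
      using cl by (simp only: conj1) (simp add: m_assoc)
    finally show ?thesis using cl by (simp add: T_def)
  qed
  have "k \<otimes> inv (L x) = inv (L x') \<otimes> k"
  proof -
    have "L x' \<otimes> k \<otimes> inv (L x) = k" using H_L[OF k(1) x, symmetric] cl by (simp add: x'_def m_assoc)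
    then show ?thesis using cl by (metis cancel_left(2) inv_closed m_assoc m_closed L_closed)
  qed
  then have T2: "T = inv (L x') \<otimes> L x"
    using cl k(3) by (simp add: T1) (simp add: m_assoc kk)
  \<comment> \<open>\<open>L a \<otimes> inv (L r)\<close> commutes with
    \<open>L x = L (L a r)\<close> and so with \<open>S\<close>; hence \<open>L a\<close> and
    \<open>L r\<close> have the same commutator with \<open>S\<close>.\<close>
  have T3: "T = inv (L r) \<otimes> L d"
  proof -
    define g where "g = L a \<otimes> inv (L r)"
    have gc: "g \<in> carrier G" using cl by (simp add: g_def)
    have "L x \<otimes> g = g \<otimes> L x" using commute_quotient[OF a r(1)] r by (simp add: g_def)
    then have "g \<otimes> S = S \<otimes> g"
      unfolding S_def by (intro commute_mult) (use gc x in simp_all)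
    then have "g \<otimes> inv S = inv S \<otimes> g" using commute_inv[OF gc Sc] by simp
    then have "inv (L a) \<otimes> (g \<otimes> inv S) \<otimes> (L r \<otimes> S) = inv (L a) \<otimes> (inv S \<otimes> g) \<otimes> (L r \<otimes> S)"
      by simp
    then show ?thesis using cl by (simp add: T_def Lb Ld g_def m_assoc)
  qed
  \<comment> \<open>Both factors in \<open>T1\<close> square to \<open>\<one>\<close>, and
    conjugation by \<open>k\<close> reverses their order.\<close>
  have kTk: "k \<otimes> T \<otimes> k = inv T"
    using cl kk k by (simp add: T1 inv_mult_group m_assoc)
  define p where "p = T e"
  have p: "p \<in> Q" using Tc by (simp add: p_def)
  define \<theta> where "\<theta> = inv T \<otimes> L p"
  have \<theta>: "\<theta> \<in> H" using cl p by (intro H_I) (simp_all add: \<theta>_def, simp add: p_def)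
  have \<theta>c: "\<theta> \<in> carrier G" using \<theta> by simp
  have Lp: "L p = T \<otimes> \<theta>" using cl p by (simp add: \<theta>_def)
  have LaT: "L a \<otimes> T = L b" using cl by (simp add: T_def)
  have LrT: "L r \<otimes> T = L d" using cl by (simp add: T3)
  have Lx'T: "L x' \<otimes> T = L x" using cl by (simp add: T2)
  have fixed: "\<theta> y = y" if y: "y \<in> Q" "y' \<in> Q" "L y \<otimes> T = L y'" for y y'
  proof -
    have yp: "L y p = y'" using act_eqI[OF y(3), of e] cl y by (simp add: p_def)
    have "L y \<otimes> L p = L y' \<otimes> \<theta>" using y cl \<theta>c by (simp add: Lp y(3)[symmetric] m_assoc)
    then have "L y (L p y) = L y' (\<theta> y)" using act_eqI[of "L y" "L p" "L y' \<otimes> \<theta>" y] y p \<theta>c by simp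
    moreover have "L y (L p y) = L y' y" using yp L_comm y p by simp
    ultimately show ?thesis using act_inj[of "L y'" "\<theta> y" y] y \<theta>c by simp
  qed
  have \<theta>a: "\<theta> a = a" using fixed LaT cl by blast
  have \<theta>r: "\<theta> r = r" using fixed LrT cl by blast
  have \<theta>x: "\<theta> x = x" using L_aut[of \<theta> a r] \<theta> \<theta>a \<theta>r cl r by simp
  have \<theta>La: "\<theta> \<otimes> L a = L a \<otimes> \<theta>" using H_L_commute[OF \<theta> a \<theta>a] .
  have \<theta>Lx: "\<theta> \<otimes> L x = L x \<otimes> \<theta>" using H_L_commute[OF \<theta> x \<theta>x] .
  have \<theta>k: "\<theta> \<otimes> k = k \<otimes> \<theta>"
    unfolding k_def c_def using \<theta>La \<theta>Lx cl \<theta>c by (intro commute_mult commute_inv) simp_all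
  have \<theta>T: "\<theta> \<otimes> T = T \<otimes> \<theta>"
    unfolding T1 using \<theta>k \<theta>Lx cl \<theta>c by (intro commute_mult commute_inv) simp_all
  \<comment> \<open>As \<open>\<theta>\<close> commutes with \<open>T\<close> and fixes
    \<open>e\<close>, exponent 2 at \<open>p\<close> becomes \<open>T (T e) = e\<close>.\<close>
  have "L p (L p e) = e" using p by simp
  moreover have "L p (L p e) = T (T e)"
  proof -
    have "L p \<otimes> L p = T \<otimes> T \<otimes> (\<theta> \<otimes> \<theta>)"
      using \<theta>T Tc \<theta>c unfolding Lp by (metis m_assoc m_closed)
    then show ?thesis
      using act_eqI[of "L p" "L p" "T \<otimes> T \<otimes> (\<theta> \<otimes> \<theta>)" e] p Tc \<theta> \<theta>c by simp
  qed
  ultimately have "T p = e" by (simp add: p_def)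
  then have invTe: "(inv T) e = p" using act_inv(1)[OF Tc p] by simp
  \<comment> \<open>Conjugation by \<open>k\<close> turns \<open>L p = T \<otimes> \<theta>\<close>
    into \<open>L (k p) = inv T \<otimes> \<theta>\<close>; evaluation at \<open>e\<close> gives
    \<open>k p = p\<close>, so \<open>T\<close> is its own inverse.\<close>
  have "k \<otimes> L p \<otimes> k = inv T \<otimes> \<theta>"
    using \<theta>k kTk cl \<theta>c unfolding Lp by (metis m_assoc m_closed)
  moreover have "k \<otimes> L p \<otimes> k = L (k p)"
    using H_L[OF k(1) p] k cl p by (simp add: m_assoc)
  ultimately have Lkp: "L (k p) = inv T \<otimes> \<theta>" by simp
  have "L (k p) e = (inv T \<otimes> \<theta>) e" using Lkp by simp
  then have "k p = p" using invTe cl \<theta> \<theta>c p by simp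
  then have "T \<otimes> \<theta> = inv T \<otimes> \<theta>" using Lkp Lp by simp
  then have Tinv: "inv T = T" using cl \<theta>c by simp
  then have LxT: "L x \<otimes> T = L x'" using Lx'T cl by (metis cancel_left(1) m_assoc inv_closed r_inv r_one L_closed)
  have h\<theta>: "h y p = \<theta>" if y: "y \<in> Q" "y' \<in> Q" "L y \<otimes> T = L y'" for y y'
  proof -
    have yp: "L y p = y'" using act_eqI[OF y(3), of e] cl y by (simp add: p_def)
    have "L y \<otimes> L p = L y' \<otimes> \<theta>" using y cl \<theta>c by (simp add: Lp y(3)[symmetric] m_assoc)
    then show ?thesis using y cl \<theta>c p by (simp add: h_def yp m_assoc)
  qed
  have "(inv \<theta>) z = z" if z: "z \<in> Q" for z
  proof -
    define \<Phi> where "\<Phi> = h z p"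
    define u where "u = (inv \<theta>) z"
    \<comment> \<open>\<open>exchange\<close> with \<open>p\<close> for \<open>v\<close> says that
      \<open>L u\<close> and \<open>L z \<otimes> inv \<Phi>\<close> agree at each \<open>y\<close>
      with \<open>h y p = \<theta>\<close>. Thus \<open>\<Lambda>\<close> fixes \<open>a\<close>,
      \<open>r\<close> and \<open>x = L a r\<close>, hence \<open>e\<close>, and this forces
      \<open>u = z\<close>.\<close>
    define \<Lambda> where "\<Lambda> = inv (L u) \<otimes> L z \<otimes> inv \<Phi>"
    have \<Phi>: "\<Phi> \<in> H" using z p by (simp add: \<Phi>_def)
    have \<Phi>c: "\<Phi> \<in> carrier G" using \<Phi> by simp
    have u: "u \<in> Q" using z \<theta>c by (simp add: u_def)
    have \<Lambda>c: "\<Lambda> \<in> carrier G" using u z \<Phi>c by (simp add: \<Lambda>_def)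
    have "\<Lambda> y = y" if y: "y \<in> Q" "h y p = \<theta>" for y
    proof -
      have "L y u = L z ((inv \<Phi>) y)" using exchange[OF p y(1) z] y by (simp add: u_def \<Phi>_def)
      then have "L z ((inv \<Phi>) y) = L u y" using L_comm[OF y(1) u] by simp
      then show ?thesis using y u z \<Phi>c by (simp add: \<Lambda>_def)
    qed
    then have "\<Lambda> a = a" "\<Lambda> r = r" "\<Lambda> x = x"
      using h\<theta>[OF a b LaT] h\<theta>[OF r(1) d LrT] h\<theta>[OF x x' LxT] cl by simp_all
    then have "\<Lambda> e = e" using affine_fix[OF \<Lambda>c a _ r(1)] r by simp
    then have "(inv (L u)) z = e" using \<Phi> \<Phi>c u z by (simp add: \<Lambda>_def)
    then have "L u e = z" using act_inv(2)[of "L u" z] u z by simp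
    then show ?thesis using u by (simp add: u_def)
  qed
  then have "inv \<theta> = \<one>" using \<theta>c by (intro act_ext) simp_all
  then have "\<theta> = \<one>" using \<theta>c by (metis inv_inv inv_one)
  then have LpT: "L p = T" using Lp Tc by simp
  have "L p \<otimes> L p = \<one>" using Tinv Tc unfolding LpT by (metis l_inv)
  moreover have "p \<noteq> e"
  proof
    assume "p = e"
    then have "b = L a e" using act_eqI[OF LaT, of e] cl by (simp add: p_def[symmetric])
    then have "(inv S) a = a" using a by (simp add: b_def)
    then have "S a = a" using act_inv(2)[OF Sc a] by simp
    then show False using moved x a by (simp add: S_def)
  qed
  ultimately show ?thesis using p by blast
qed

lemma ex_involution:
  assumes "y \<in> Q" "y \<noteq> e"
  shows "\<exists>v\<in>Q. v \<noteq> e \<and> L v \<otimes> L v = \<one>"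
proof (cases "\<forall>x\<in>Q. \<forall>a\<in>Q. L x (L x a) = a")
  case True
  then have "L y \<otimes> L y = \<one>" using assms by (intro act_ext) simp_all
  then show ?thesis using assms by blast
next
  case False
  then show ?thesis using ex_involution_of_moved by blast
qed

end

section \<open>Commutators with an involutory translation\<close>

locale involution_loop = exponent_two_loop +
  fixes v
  assumes v [simp]: "v \<in> Q" and v_square: "L v \<otimes> L v = \<one>"
begin

abbreviation s where "s \<equiv> L v"

lemma s_inv [simp]: "inv s = s"
  using v_square by (simp add: inv_equality)

lemma s_s [simp]: "x \<in> Q \<Longrightarrow> s (s x) = x"
  using act_eqI[OF v_square] by simp

lemma s_cancel [simp]: "g \<in> carrier G \<Longrightarrow> s \<otimes> (s \<otimes> g) = g"
  using cancel_left(1)[of s g] by simp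

text \<open>Since \<open>s\<close> is its own inverse,
  \<open>inv (L y) \<otimes> s \<otimes> L y = s \<otimes> cv y\<close>: conjugates of
  \<open>s\<close> are studied through these maps.\<close>

definition cv where "cv y = c v y"

lemma cv_H [simp]: "y \<in> Q \<Longrightarrow> cv y \<in> H"
  and cv_inv [simp]: "y \<in> Q \<Longrightarrow> inv (cv y) = cv y"
  and cv_cancel [simp]: "\<lbrakk>y \<in> Q; g \<in> carrier G\<rbrakk> \<Longrightarrow> cv y \<otimes> (cv y \<otimes> g) = g"
  and cv_square [simp]: "y \<in> Q \<Longrightarrow> cv y \<otimes> cv y = \<one>"
  and cv_cv [simp]: "\<lbrakk>y \<in> Q; z \<in> Q\<rbrakk> \<Longrightarrow> cv y (cv y z) = z"
  by (simp_all add: cv_def c_square)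

lemma cv_carrier [simp]: "y \<in> Q \<Longrightarrow> cv y \<in> carrier G"
  using cv_H H_carrier by blast

lemma cv_closed [simp]: "\<lbrakk>y \<in> Q; z \<in> Q\<rbrakk> \<Longrightarrow> cv y z \<in> Q"
  by (rule act_closed) simp_all

lemma cv_v [simp]: "y \<in> Q \<Longrightarrow> cv y v = v"
proof -
  assume y: "y \<in> Q"
  have "s (L y v) = y" using y L_comm[of y v] by simp
  then show ?thesis using y L_inv_e[of v] by (simp add: cv_def c_def)
qed

definition \<xi> where "\<xi> y = h y v"

lemma xi_H [simp]: "y \<in> Q \<Longrightarrow> \<xi> y \<in> H"
  and xi_fix [simp]: "y \<in> Q \<Longrightarrow> \<xi> y y = y"
  by (simp_all add: \<xi>_def)

lemma xi_carrier [simp]: "y \<in> Q \<Longrightarrow> \<xi> y \<in> carrier G"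
  using xi_H H_carrier by blast

lemma xi_v [simp]:
  assumes y: "y \<in> Q"
  shows "\<xi> y v = v"
proof -
  have "L (L y v) v = y" using y L_comm[of y v] L_comm[of "s y" v] by simp
  then have "(inv (L (L y v))) y = v" using y act_inv(1)[of "L (L y v)" v] by simp
  then show ?thesis using y by (simp add: \<xi>_def h_def)
qed

text \<open>\<open>\<xi> y\<close> fixes both \<open>y\<close> and \<open>v\<close>, so it commutes
  with \<open>L y\<close> and \<open>s\<close>, from which \<open>cv y\<close> is built.\<close>

lemma xi_cv_commute: "y \<in> Q \<Longrightarrow> \<xi> y \<otimes> cv y = cv y \<otimes> \<xi> y"
  unfolding cv_def c_def using H_L_commute[of "\<xi> y" y] H_L_commute[of "\<xi> y" v]
  by (intro commute_mult commute_inv) simp_all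

text \<open>An element of \<open>H\<close> fixing \<open>v\<close> commutes with \<open>s\<close>,
  so it carries commutators with \<open>s\<close> to such commutators. By \<open>cv_v\<close> the
  maps \<open>cv z\<close> are themselves of this kind.\<close>

lemma stab_cv:
  assumes \<phi>: "\<phi> \<in> H" "\<phi> v = v" and y: "y \<in> Q"
  shows "cv (\<phi> y) = \<phi> \<otimes> cv y \<otimes> inv \<phi>"
proof -
  have \<phi>c: "\<phi> \<in> carrier G" using \<phi> by simp
  have 1: "L (\<phi> y) = \<phi> \<otimes> L y \<otimes> inv \<phi>" using H_L[OF \<phi>(1) y] \<phi>c y by (simp add: m_assoc)
  have 2: "s = \<phi> \<otimes> s \<otimes> inv \<phi>" using H_L[OF \<phi>(1) v] \<phi> \<phi>c by (simp add: m_assoc)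
  have "cv (\<phi> y) = inv (\<phi> \<otimes> s \<otimes> inv \<phi>) \<otimes> inv (\<phi> \<otimes> L y \<otimes> inv \<phi>) \<otimes> (\<phi> \<otimes> s \<otimes> inv \<phi>) \<otimes> (\<phi> \<otimes> L y \<otimes> inv \<phi>)"
    unfolding cv_def c_def 1 using 2 by simp
  also have "\<dots> = \<phi> \<otimes> cv y \<otimes> inv \<phi>"
    unfolding cv_def c_def using \<phi>c y by (simp add: m_assoc inv_mult_group)
  finally show ?thesis .
qed

lemma stab_xi:
  assumes \<phi>: "\<phi> \<in> H" "\<phi> v = v" and y: "y \<in> Q"
  shows "\<xi> (\<phi> y) = \<phi> \<otimes> \<xi> y \<otimes> inv \<phi>"
proof -
  have \<phi>c: "\<phi> \<in> carrier G" using \<phi> by simp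
  have 1: "L (\<phi> z) = \<phi> \<otimes> L z \<otimes> inv \<phi>" if "z \<in> Q" for z
    using H_L[OF \<phi>(1) that] \<phi>c that by (simp add: m_assoc)
  have 2: "L (\<phi> y) v = \<phi> (L y v)" using L_aut[of \<phi> y v] \<phi> \<phi>c y by simp
  have "\<xi> (\<phi> y) = inv (L (\<phi> (L y v))) \<otimes> L (\<phi> y) \<otimes> L (\<phi> v)"
    unfolding \<xi>_def h_def 2 by (simp add: \<phi>)
  also have "\<dots> = \<phi> \<otimes> \<xi> y \<otimes> inv \<phi>"
    unfolding \<xi>_def h_def using \<phi>c y 1[of "L y v"] 1[of y] 1[of v] by (simp add: m_assoc inv_mult_group)
  finally show ?thesis .
qed

text \<open>\<open>\<xi> y\<close> is an automorphism fixing \<open>y\<close>, so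
  \<open>exchange\<close> becomes the agreement of two inner mappings at the product of
  \<open>y\<close> and \<open>z\<close>.\<close>

lemma xi_swap:
  assumes "y \<in> Q" "z \<in> Q"
  shows "(inv (\<xi> y)) (L y z) = (inv (\<xi> z)) (L y z)"
proof -
  have *: "(inv (\<xi> y)) (L y z) = L y ((inv (\<xi> y)) z)" if "y \<in> Q" "z \<in> Q" for y z
    using L_aut[of "inv (\<xi> y)" y z] that H_inv[OF xi_H[of y]] act_inv_fix[of "\<xi> y" y] by simp
  have "(inv (\<xi> y)) (L y z) = L z ((inv (\<xi> z)) y)"
    using *[OF assms] exchange[OF v assms] by (simp add: \<xi>_def)
  also have "\<dots> = (inv (\<xi> z)) (L z y)" using * assms by simp
  finally show ?thesis using L_comm assms by simp
qed

lemma L_s: "z \<in> Q \<Longrightarrow> L z \<otimes> s = s \<otimes> L z \<otimes> cv z"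
  using c_swap[of v z] by (simp add: cv_def)

text \<open>Applying \<open>s\<close> to either side gives the product of \<open>L y v\<close> and
  \<open>z\<close>: once by writing \<open>L (L y v)\<close> through \<open>\<xi> y\<close>, once by
  moving \<open>s\<close> past \<open>L z\<close>.\<close>

lemma twist:
  assumes y: "y \<in> Q" and z: "z \<in> Q"
  shows "L y (cv y ((inv (\<xi> y)) z)) = L z (cv z y)"
proof -
  have "L (L y v) = L y \<otimes> s \<otimes> inv (\<xi> y)"
    using L_mult[OF y v] y by (simp add: \<xi>_def m_assoc)
  also have "\<dots> = s \<otimes> L y \<otimes> cv y \<otimes> inv (\<xi> y)" using L_s[OF y] by simp
  finally have "L (L y v) z = (s \<otimes> L y \<otimes> cv y \<otimes> inv (\<xi> y)) z" by simp
  then have 1: "L (L y v) z = s (L y (cv y ((inv (\<xi> y)) z)))" using y z by simp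
  have "L z (s y) = s (L z (cv z y))" using act_eqI[OF L_s[OF z], of y] y z by simp
  moreover have "L (L y v) z = L z (s y)" using L_comm[of y v] L_comm[of "s y" z] y z by simp
  ultimately have "s (L y (cv y ((inv (\<xi> y)) z))) = s (L z (cv z y))" using 1 by simp
  then show ?thesis using act_inj[of s] y z by simp
qed

lemma stab_cv_apply:
  assumes "\<phi> \<in> H" "\<phi> v = v" "y \<in> Q" "z \<in> Q"
  shows "cv (\<phi> y) (\<phi> z) = \<phi> (cv y z)"
proof -
  have "\<phi> \<in> carrier G" using assms(1) by simp
  then show ?thesis using stab_cv[OF assms(1-3)] assms(3,4) by simp
qed

text \<open>Starting from \<open>L z (cv z y)\<close>, \<open>twist\<close> brings in
  \<open>\<xi> y\<close>, \<open>xi_swap\<close> trades it for \<open>\<xi> z\<close>, and a second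
  \<open>twist\<close> removes that.\<close>

lemma cv_commute_aux:
  assumes y: "y \<in> Q" and z: "z \<in> Q"
  shows "cv y (cv z (L y (cv z z))) = cv z (cv y (L y (cv z z)))"
proof -
  have aut: "cv x (L a b) = L (cv x a) (cv x b)" if "x \<in> Q" "a \<in> Q" "b \<in> Q" for x a b
    using L_aut[of "cv x" a b] H_e[OF cv_H[OF that(1)]] that by simp
  have xi_aut: "(inv (\<xi> x)) (L x b) = L x ((inv (\<xi> x)) b)" if "x \<in> Q" "b \<in> Q" for x b
    using L_aut[of "inv (\<xi> x)" x b] that H_inv[OF xi_H[of x]] act_inv_fix[of "\<xi> x" x] by simp
  have xi_cv: "(inv (\<xi> x)) (cv x b) = cv x ((inv (\<xi> x)) b)" if "x \<in> Q" "b \<in> Q" for x b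
  proof -
    have "cv x \<otimes> inv (\<xi> x) = inv (\<xi> x) \<otimes> cv x"
      using commute_inv[of "cv x" "\<xi> x"] xi_cv_commute[OF that(1)] that by simp
    then show ?thesis using act_eqI[of "cv x" "inv (\<xi> x)" "inv (\<xi> x) \<otimes> cv x" b] that by simp
  qed
  \<comment> \<open>This allows \<open>xi_swap\<close> at the product of \<open>cv y y\<close> and
    \<open>z\<close>.\<close>
  have xi_same: "\<xi> (cv y y) = \<xi> y"
  proof -
    have "\<xi> (cv y y) = cv y \<otimes> \<xi> y \<otimes> cv y" using stab_xi[of "cv y" y] y by simp
    also have "\<dots> = \<xi> y" using xi_cv_commute[OF y] y by (metis cv_cancel cv_carrier m_assoc xi_carrier cv_square r_one)
    finally show ?thesis .
  qed
  \<comment> \<open>Chosen so that \<open>cv z w = cv y y\<close>, which produces the left side of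
    \<open>twist\<close> for \<open>z\<close> and \<open>w\<close>.\<close>
  define w where "w = cv z (cv y y)"
  have w: "w \<in> Q" using y z by (simp add: w_def)
  have "L z (cv z y) = L y ((inv (\<xi> y)) (cv y z))"
    using twist[OF y z] xi_cv[OF y z] by simp
  also have "\<dots> = (inv (\<xi> y)) (L y (cv y z))" using xi_aut y z by simp
  also have "L y (cv y z) = cv y (L (cv y y) z)" using aut y z by simp
  also have "(inv (\<xi> y)) (cv y (L (cv y y) z)) = cv y ((inv (\<xi> y)) (L (cv y y) z))"
    using xi_cv y z by simp
  also have "(inv (\<xi> y)) (L (cv y y) z) = (inv (\<xi> z)) (L (cv y y) z)"
    using xi_swap[of "cv y y" z] xi_same y z by simp
  finally have "cv y (L z (cv z y)) = (inv (\<xi> z)) (L (cv y y) z)" using y z by simp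
  also have "\<dots> = L z ((inv (\<xi> z)) (cv y y))"
    using xi_aut[of z "cv y y"] L_comm[of "cv y y" z] y z by simp
  also have "(inv (\<xi> z)) (cv y y) = cv z ((inv (\<xi> z)) w)"
    using xi_cv[of z "cv z (cv y y)"] xi_cv[of z "cv y y"] y z by (simp add: w_def)
  also have "L z (cv z ((inv (\<xi> z)) w)) = L w (cv w z)" using twist[OF z w] .
  also have "\<dots> = cv z (cv y (L y (cv z z)))"
  proof -
    have "cv w z = cv z (cv (cv y y) (cv z z))"
      using stab_cv_apply[of "cv z" "cv y y" "cv z z"] y z by (simp add: w_def)
    also have "cv (cv y y) (cv z z) = cv y (cv y (cv y (cv z z)))"
      using stab_cv_apply[of "cv y" y "cv y (cv z z)"] y z by simp
    finally have "cv w z = cv z (cv y (cv z z))" using y z by simp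
    then show ?thesis using aut y z by (simp add: w_def)
  qed
  finally have "cv y (L z (cv z y)) = cv z (cv y (L y (cv z z)))" .
  moreover have "cv y (L z (cv z y)) = cv y (cv z (L y (cv z z)))"
    using aut L_comm[of "cv z y" z] y z by simp
  ultimately show ?thesis by simp
qed

text \<open>Put \<open>cv z z\<close> for \<open>z\<close> in \<open>cv_commute_aux\<close>:
  conjugating \<open>cv z\<close> by itself changes nothing, so
  \<open>cv (cv z z) = cv z\<close>.\<close>

lemma cv_commute:
  assumes y: "y \<in> Q" and z: "z \<in> Q"
  shows "cv y (cv z (L y z)) = cv z (cv y (L y z))"
proof -
  have "cv (cv z z) = cv z"
    using stab_cv[of "cv z" z] z by (simp add: m_assoc)
  then show ?thesis using cv_commute_aux[of y "cv z z"] y z by simp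
qed

text \<open>Since \<open>cv (a z) = a (cv z) a\<^sup>-\<^sup>1\<close>, the rule \<open>cv_commute\<close> for \<open>a z\<close> and \<open>z\<close> says that the fourth power of
  \<open>a\<close> fixes the product of \<open>a z\<close> and \<open>z\<close>; as \<open>a\<close> has odd order, it fixes that product, hence \<open>z\<close>.\<close>

lemma inverted_trivial:
  assumes a: "a \<in> H" "a v = v" and k: "odd (k::nat)" "a [^] k = \<one>"
    and z: "z \<in> Q" and inverts: "cv z \<otimes> a \<otimes> cv z = inv a"
  shows "a = \<one>"
proof -
  have ac: "a \<in> carrier G" using a by simp
  define y where "y = a z"
  have y: "y \<in> Q" using ac z by (simp add: y_def)
  have "cv z \<otimes> a = inv a \<otimes> cv z"
  proof -
    have "cv z \<otimes> a \<otimes> cv z \<otimes> cv z = inv a \<otimes> cv z" using inverts by simp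
    then show ?thesis using ac z by (simp add: m_assoc)
  qed
  then have za: "cv z (a b) = (inv a) (cv z b)" if "b \<in> Q" for b
    using act_eqI[of "cv z" a "inv a \<otimes> cv z" b] ac z that by simp
  have az: "cv z ((inv a) b) = a (cv z b)" if "b \<in> Q" for b
    using za[of "(inv a) b"] ac z that by simp
  have cy: "cv y b = a (cv z ((inv a) b))" if "b \<in> Q" for b
    using stab_cv[OF a z] ac z that by (simp add: y_def)
  define w where "w = L y z"
  have w: "w \<in> Q" using y z by (simp add: w_def)
  have "cv y (cv z w) = cv z (cv y w)" using cv_commute[OF y z] by (simp add: w_def)
  then have "a (a w) = (inv a) ((inv a) w)" using cy za az ac z w by simp
  then have "a (a (a (a w))) = w" using ac w by simp
  then have "(a \<otimes> a) w = w"
    by (intro odd_power_fix[of "a \<otimes> a" w k]) (use ac w k in \<open>simp_all add: pow_mult_distrib\<close>)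
  then have "a w = w" using odd_power_fix[OF ac w k] ac w by simp
  \<comment> \<open>The fixed product shows that \<open>a\<close> interchanges \<open>y\<close> and
    \<open>z\<close>, and odd order then forces \<open>a z = z\<close>.\<close>
  then have "L (a y) y = L y z" using L_aut[OF ac H_e[OF a(1)] y z] by (simp add: w_def y_def)
  then have "L y (a y) = L y z" using L_comm[of "a y" y] ac y by simp
  then have "a y = z" using act_inj[of "L y" "a y" z] ac y z by simp
  then have "a z = z" using odd_power_fix[OF ac z k] by (simp add: y_def)
  \<comment> \<open>Now \<open>y = z\<close>, so \<open>a\<close> commutes with \<open>cv z\<close>,
    which also inverts it; hence the square of \<open>a\<close> is trivial.\<close>
  then have "cv z b = a (cv z ((inv a) b))" if "b \<in> Q" for b using cy that by (simp add: y_def)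
  then have aab: "a (a (cv z b)) = cv z b" if "b \<in> Q" for b using az ac z that by simp
  show ?thesis
  proof (rule act_ext)
    fix b assume b: "b \<in> Q"
    have "a (a b) = b" using aab[of "cv z b"] b z by simp
    then show "a b = \<one> b" using odd_power_fix[OF ac b k] b by simp
  qed (use ac in simp_all)
qed

lemma involution_normal_two_subgroup:
  assumes finG: "finite (carrier G)" and finQ: "finite Q" and cardQ: "card Q = 2 ^ n"
  shows "\<exists>N. N \<lhd> G \<and> two_subgroup G N \<and> s \<in> N"
proof (rule baer_involution[OF finG])
  show "s \<in> carrier G" "s \<otimes> s = \<one>" by (simp_all add: v_square)
  fix g assume g: "g \<in> carrier G"
  define t where "t = s \<otimes> (g \<otimes> s \<otimes> inv g)"
  have tc: "t \<in> carrier G" using g by (simp add: t_def)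
  have "s \<otimes> t \<otimes> s \<otimes> t = \<one>" using g by (simp add: t_def m_assoc v_square)
  then have st: "s \<otimes> t \<otimes> inv s = inv t" using tc by (simp add: inv_equality)
  have "\<exists>j. ord t = 2 ^ j"
  proof (rule ccontr)
    assume no: "\<nexists>j. ord t = 2 ^ j"
    have ord0: "ord t \<noteq> 0" using ord_ge_1[OF finG tc] by simp
    have "\<exists>p. Factorial_Ring.prime p \<and> p dvd ord t \<and> p \<noteq> 2"
    proof (rule ccontr)
      assume "\<nexists>p. Factorial_Ring.prime p \<and> p dvd ord t \<and> p \<noteq> 2"
      then have "prime_factors (ord t) \<subseteq> {2}" by (auto simp: prime_factors_dvd)
      then have "prime_factors (ord t) = {} \<or> prime_factors (ord t) = {2}" by auto
      then have "ord t = (\<Prod>p\<in>prime_factors (ord t). p ^ multiplicity p (ord t))"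
        using prime_factorization_nat[of "ord t"] ord0 by simp
      moreover have "(\<Prod>p\<in>prime_factors (ord t). p ^ multiplicity p (ord t)) \<in> {2 ^ 0, 2 ^ multiplicity 2 (ord t)}"
        using \<open>prime_factors (ord t) = {} \<or> _\<close> by auto
      ultimately have "ord t \<in> {2 ^ 0, 2 ^ multiplicity 2 (ord t)}" by metis
      then show False using no by blast
    qed
    then obtain p where p: "Factorial_Ring.prime p" "p dvd ord t" "p \<noteq> 2" by blast
    have podd: "odd p" using p primes_dvd_imp_eq two_is_prime_nat by blast
    define i where "i = ord t div p"
    define A where "A = t [^] i"
    have i0: "i \<noteq> 0" and idvd: "i dvd ord t" and "ord t div i = p"
      using p ord0 by (auto simp: i_def)
    then have ordA: "ord A = p" using ord_pow[OF tc idvd i0] by (simp add: A_def)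
    have Ac: "A \<in> carrier G" using tc by (simp add: A_def)
    have sA: "s \<otimes> A \<otimes> inv s = inv A"
      using pow_conjugate[of s t i] tc st by (simp add: A_def nat_pow_inv)
    have "subgroup (generate G {A}) G" using Ac generate_is_subgroup by simp
    moreover have "card (generate G {A}) = p ^ 1" using generate_pow_card[OF Ac] ordA by simp
    \<comment> \<open>A group of odd prime order acts on \<open>2 ^ n\<close> points, so its number
      of fixed points is not divisible by \<open>p\<close>.\<close>
    ultimately have "card Q mod p = card {x \<in> Q. \<forall>g\<in>generate G {A}. g x = x} mod p"
      using finQ p(1)
      by (intro prime_power_fixed_points[where n = 1]) (auto simp: subgroup.mem_carrier)
    moreover have "card Q mod p \<noteq> 0"
      using cardQ podd p(1) by (metis mod_eq_0_iff_dvd prime_dvd_power p(3) primes_dvd_imp_eq two_is_prime_nat)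
    ultimately have "card {x \<in> Q. \<forall>g\<in>generate G {A}. g x = x} \<noteq> 0" by (metis mod_0)
    then have "{x \<in> Q. \<forall>g\<in>generate G {A}. g x = x} \<noteq> {}" by (metis card.empty)
    then obtain z where z: "z \<in> Q" "A z = z" using generate.incl[of A "{A}" G] by auto
    \<comment> \<open>Conjugation by \<open>L z\<close> moves the fixed point to \<open>e\<close>
      and turns \<open>s\<close> into \<open>s \<otimes> cv z\<close>.\<close>
    define a where "a = inv (L z) \<otimes> A \<otimes> L z"
    have a: "a \<in> H" unfolding a_def by (rule H_I) (use Ac z in simp_all)
    have ac: "a \<in> carrier G" using a by simp
    have sz: "inv (L z) \<otimes> s \<otimes> L z = s \<otimes> cv z"
      using z by (simp add: cv_def c_def m_assoc)
    have inverts: "(s \<otimes> cv z) \<otimes> a \<otimes> inv (s \<otimes> cv z) = inv a"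
    proof -
      have "(s \<otimes> cv z) \<otimes> a \<otimes> inv (s \<otimes> cv z) = inv (L z) \<otimes> (s \<otimes> A \<otimes> inv s) \<otimes> L z"
        unfolding sz[symmetric] a_def using z Ac by (simp add: m_assoc inv_mult_group)
      also have "\<dots> = inv a" unfolding sA a_def using z Ac by (simp add: m_assoc inv_mult_group)
      finally show ?thesis .
    qed
    then have "(s \<otimes> cv z) \<otimes> a = inv a \<otimes> (s \<otimes> cv z)"
      using ac z by (metis inv_solve_right m_closed inv_closed L_closed v cv_carrier)
    \<comment> \<open>Evaluation at \<open>e\<close> shows that \<open>a\<close> fixes
      \<open>v\<close>; then \<open>a\<close> commutes with \<open>s\<close>, and
      \<open>cv z\<close> alone inverts \<open>a\<close>.\<close>
    then have "((s \<otimes> cv z) \<otimes> a) e = (inv a \<otimes> (s \<otimes> cv z)) e" by simp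
    then have "(inv a) v = v" using a ac z H_e[OF cv_H[OF z(1)]] by simp
    then have av: "a v = v" using act_inv(2)[OF ac v] by simp
    have sa: "s \<otimes> inv a \<otimes> s = inv a"
      using commute_inv[of s a] H_L_commute[OF a v av] ac by (simp add: m_assoc v_square)
    have "cv z \<otimes> a \<otimes> cv z = s \<otimes> ((s \<otimes> cv z) \<otimes> a \<otimes> inv (s \<otimes> cv z)) \<otimes> s"
      using ac z by (simp add: m_assoc inv_mult_group v_square)
    then have "cv z \<otimes> a \<otimes> cv z = inv a" unfolding inverts sa .
    moreover have "a [^] p = \<one>"
      using pow_conjugate[of "inv (L z)" A p] z Ac ordA pow_ord_eq_1[OF Ac] by (simp add: a_def)
    ultimately have "a = \<one>" using inverted_trivial[OF a av podd _ z(1)] by blast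
    moreover have "A = L z \<otimes> a \<otimes> inv (L z)" using z Ac by (simp add: a_def m_assoc)
    ultimately have "A = \<one>" using z by simp
    then show False using ordA p(1) by auto
  qed
  then show "\<exists>n. (s \<otimes> (g \<otimes> s \<otimes> inv g)) [^] ((2::nat) ^ n) = \<one>"
    using pow_ord_eq_1[OF tc] by (metis t_def)
qed

end

lemma (in exponent_two_loop) ex_normal_two_subgroup:
  assumes finG: "finite (carrier G)" and finQ: "finite Q" and cardQ: "card Q = 2 ^ n" and n: "n \<ge> 1"
  shows "\<exists>N. N \<lhd> G \<and> two_subgroup G N \<and> N \<noteq> {\<one>}"
proof -
  have "even (card Q)" using cardQ n by simp
  then obtain y where "y \<in> Q" "y \<noteq> e" using even_card_other_point[OF finQ _ e] by blast
  then obtain v where v: "v \<in> Q" "v \<noteq> e" "L v \<otimes> L v = \<one>" using ex_involution by blast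
  interpret v: involution_loop G Q L e v by unfold_locales (use v in simp_all)
  have "L v \<noteq> \<one>"
  proof
    assume "L v = \<one>"
    then have "L v e = e" by simp
    then show False using v by simp
  qed
  then show ?thesis using v.involution_normal_two_subgroup[OF finG finQ cardQ] by blast
qed

section \<open>Multiplication groups and primitivity\<close>

lemma BijGroup_simps:
  "carrier (BijGroup Q) = Bij Q"
  "\<lbrakk>g \<in> Bij Q; h \<in> Bij Q; x \<in> Q\<rbrakk> \<Longrightarrow> (g \<otimes>\<^bsub>BijGroup Q\<^esub> h) x = g (h x)"
  "x \<in> Q \<Longrightarrow> \<one>\<^bsub>BijGroup Q\<^esub> x = x"
  by (simp_all add: BijGroup_def compose_def)

lemma perm_group_BijGroup: "perm_group (BijGroup Q) Q"
proof -
  interpret group "BijGroup Q" by (rule group_BijGroup)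
  show ?thesis
  proof
    fix g h assume "g \<in> carrier (BijGroup Q)" "h \<in> carrier (BijGroup Q)"
      and "\<And>x. x \<in> Q \<Longrightarrow> g x = h x"
    then show "g = h" by (intro extensionalityI[of _ Q]) (simp_all add: BijGroup_simps Bij_def)
  qed (use Bij_imp_funcset in \<open>auto simp: BijGroup_simps\<close>)
qed

lemma (in perm_group) perm_group_subgroup:
  assumes "subgroup K G"
  shows "perm_group (G\<lparr>carrier := K\<rparr>) Q"
proof -
  interpret K: group "G\<lparr>carrier := K\<rparr>"
    by (rule subgroup.subgroup_is_group[OF assms group_axioms])
  show ?thesis
    by unfold_locales (use subgroup.mem_carrier[OF assms] act_ext in auto)
qed

lemma finite_Bij: "finite Q \<Longrightarrow> finite (Bij Q)"
  by (rule finite_subset[OF _ finite_PiE]) (auto simp: Bij_def bij_betw_def PiE_def)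

locale nonassoc_loop =
  fixes Q :: "'a set" and m :: "'a \<Rightarrow> 'a \<Rightarrow> 'a" and e :: 'a
  assumes loop: "loop Q m e"
begin

lemma m_closed_Q [simp]: "\<lbrakk>x \<in> Q; y \<in> Q\<rbrakk> \<Longrightarrow> m x y \<in> Q"
  and e_Q [simp]: "e \<in> Q"
  and m_e [simp]: "x \<in> Q \<Longrightarrow> m e x = x" "x \<in> Q \<Longrightarrow> m x e = x"
  using loop by (auto simp: loop_def)

lemma left_div: "\<lbrakk>a \<in> Q; b \<in> Q\<rbrakk> \<Longrightarrow> \<exists>!x. x \<in> Q \<and> m a x = b"
  and right_div: "\<lbrakk>a \<in> Q; b \<in> Q\<rbrakk> \<Longrightarrow> \<exists>!y. y \<in> Q \<and> m y a = b"
  using loop by (auto simp: loop_def)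

lemma left_cancel: "\<lbrakk>m a x = m a y; a \<in> Q; x \<in> Q; y \<in> Q\<rbrakk> \<Longrightarrow> x = y"
  using left_div[of a "m a y"] by (metis m_closed_Q)

lemma right_cancel: "\<lbrakk>m x a = m y a; a \<in> Q; x \<in> Q; y \<in> Q\<rbrakk> \<Longrightarrow> x = y"
  using right_div[of a "m y a"] by (metis m_closed_Q)

lemma Ltr_Bij: "a \<in> Q \<Longrightarrow> Ltr Q m a \<in> Bij Q"
proof -
  assume a: "a \<in> Q"
  have "inj_on (m a) Q" using left_cancel a by (auto intro: inj_onI)
  moreover have "m a ` Q = Q"
    using left_div[OF a] a by (auto simp: image_iff) (metis)
  ultimately show ?thesis by (simp add: Ltr_def Bij_def bij_betw_def)
qed

lemma Rtr_Bij: "a \<in> Q \<Longrightarrow> Rtr Q m a \<in> Bij Q"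
proof -
  assume a: "a \<in> Q"
  have "inj_on (\<lambda>x. m x a) Q" using right_cancel a by (auto intro: inj_onI)
  moreover have "(\<lambda>x. m x a) ` Q = Q"
    using right_div[OF a] a by (auto simp: image_iff) (metis)
  ultimately show ?thesis by (simp add: Rtr_def Bij_def bij_betw_def)
qed

definition T where "T = Ltr Q m ` Q \<union> Rtr Q m ` Q"
definition M where "M = generate (BijGroup Q) T"

sublocale P: perm_group "BijGroup Q" Q by (rule perm_group_BijGroup)

lemma T_carrier: "T \<subseteq> carrier (BijGroup Q)"
  using Ltr_Bij Rtr_Bij by (auto simp: T_def BijGroup_simps)

lemma M_subgroup: "subgroup M (BijGroup Q)"
  unfolding M_def using P.generate_is_subgroup T_carrier .

lemma Mlt_eq: "Mlt Q m = (BijGroup Q)\<lparr>carrier := M\<rparr>"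
  by (simp add: Mlt_def M_def T_def)

sublocale G: perm_group "Mlt Q m" Q
  unfolding Mlt_eq using P.perm_group_subgroup M_subgroup .

lemma Mlt_simps:
  "carrier (Mlt Q m) = M"
  "monoid.mult (Mlt Q m) = monoid.mult (BijGroup Q)"
  "one (Mlt Q m) = one (BijGroup Q)"
  "g \<in> M \<Longrightarrow> inv\<^bsub>Mlt Q m\<^esub> g = inv\<^bsub>BijGroup Q\<^esub> g"
  using P.m_inv_consistent[OF M_subgroup] by (simp_all add: Mlt_eq)

lemma Ltr_closed [simp]: "a \<in> Q \<Longrightarrow> Ltr Q m a \<in> carrier (Mlt Q m)"
  and Rtr_closed [simp]: "a \<in> Q \<Longrightarrow> Rtr Q m a \<in> carrier (Mlt Q m)"
  by (auto simp: Mlt_simps M_def T_def intro: generate.incl)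

lemma Ltr_apply [simp]: "x \<in> Q \<Longrightarrow> Ltr Q m a x = m a x"
  and Rtr_apply [simp]: "x \<in> Q \<Longrightarrow> Rtr Q m a x = m x a"
  by (simp_all add: Ltr_def Rtr_def)

lemma transitive: "\<lbrakk>x \<in> Q; y \<in> Q\<rbrakk> \<Longrightarrow> \<exists>g\<in>carrier (Mlt Q m). g x = y"
proof -
  assume x: "x \<in> Q" and y: "y \<in> Q"
  obtain z where "z \<in> Q" "m z x = y" using right_div[OF x y] by blast
  then show ?thesis using x by (intro bexI[of _ "Ltr Q m z"]) simp_all
qed

text \<open>The quotient of the loop by an invariant equivalence is realised on representatives, so that
  it lives on the same type.\<close>

lemma invariant_equivalence_normal:
  assumes refl: "\<And>x. x \<in> Q \<Longrightarrow> R x x"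
    and sym: "\<And>x y. \<lbrakk>x \<in> Q; y \<in> Q; R x y\<rbrakk> \<Longrightarrow> R y x"
    and trans: "\<And>x y z. \<lbrakk>x \<in> Q; y \<in> Q; z \<in> Q; R x y; R y z\<rbrakk> \<Longrightarrow> R x z"
    and invar: "\<And>g x y. \<lbrakk>g \<in> carrier (Mlt Q m); x \<in> Q; y \<in> Q; R x y\<rbrakk> \<Longrightarrow> R (g x) (g y)"
  shows "normal_subloop Q m e {x \<in> Q. R e x}"
proof -
  define f where "f x = (SOME y. y \<in> Q \<and> R x y)" for x
  have f: "f x \<in> Q" "R x (f x)" if "x \<in> Q" for x
    unfolding f_def using someI[of "\<lambda>y. y \<in> Q \<and> R x y" x] refl that by auto
  have f_eq: "f x = f y" if "x \<in> Q" "y \<in> Q" "R x y" for x y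
  proof -
    have "(\<lambda>z. z \<in> Q \<and> R x z) = (\<lambda>z. z \<in> Q \<and> R y z)"
      using that sym trans by blast
    then show ?thesis by (simp add: f_def)
  qed
  have f_iff: "f x = f y \<longleftrightarrow> R x y" if "x \<in> Q" "y \<in> Q" for x y
    using f_eq f sym trans that by metis
  have ff: "f (f x) = f x" if "x \<in> Q" for x
    using f_iff f that sym by blast
  have R_left: "R (m a x) (m a y)" if "a \<in> Q" "x \<in> Q" "y \<in> Q" "R x y" for a x y
    using invar[of "Ltr Q m a" x y] that by simp
  have R_right: "R (m x a) (m y a)" if "a \<in> Q" "x \<in> Q" "y \<in> Q" "R x y" for a x y
    using invar[of "Rtr Q m a" x y] that by simp
  \<comment> \<open>Invariance under inverse translations gives cancellation modulo
    \<open>R\<close>, hence unique division in the quotient.\<close>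
  have R_left': "R x y" if "a \<in> Q" "x \<in> Q" "y \<in> Q" "R (m a x) (m a y)" for a x y
    using invar[of "inv\<^bsub>Mlt Q m\<^esub> (Ltr Q m a)" "m a x" "m a y"] that
      G.act_inv(1)[of "Ltr Q m a" x] G.act_inv(1)[of "Ltr Q m a" y] by simp
  have R_right': "R x y" if "a \<in> Q" "x \<in> Q" "y \<in> Q" "R (m x a) (m y a)" for a x y
    using invar[of "inv\<^bsub>Mlt Q m\<^esub> (Rtr Q m a)" "m x a" "m y a"] that
      G.act_inv(1)[of "Rtr Q m a" x] G.act_inv(1)[of "Rtr Q m a" y] by simp
  have hom: "f (m x y) = f (m (f x) (f y))" if "x \<in> Q" "y \<in> Q" for x y
  proof -
    have "R (m x y) (m (f x) y)" "R (m (f x) y) (m (f x) (f y))"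
      using R_left R_right f that by auto
    then show ?thesis using f_eq f that by (metis m_closed_Q)
  qed
  let ?Q = "f ` Q" and ?m = "\<lambda>a b. f (m a b)"
  have "loop ?Q ?m (f e)"
    unfolding loop_def
  proof (intro conjI ballI)
    fix a b assume ab: "a \<in> ?Q" "b \<in> ?Q"
    then have a: "a \<in> Q" "f a = a" and b: "b \<in> Q" "f b = b" using f ff by auto
    show "f (m a b) \<in> ?Q" using a b by auto
    obtain x where x: "x \<in> Q" "m a x = b" using left_div[OF a(1) b(1)] by blast
    show "\<exists>!x. x \<in> ?Q \<and> f (m a x) = b"
    proof (rule ex1I[of _ "f x"])
      show "f x \<in> ?Q \<and> f (m a (f x)) = b" using hom[of a x] a b x by auto
      fix y assume y: "y \<in> ?Q \<and> f (m a y) = b"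
      then have yQ: "y \<in> Q" "f y = y" using f ff by auto
      have "R (m a y) (m a x)" using f_iff[of "m a y" "m a x"] y yQ a b x by simp
      then show "y = f x" using R_left' f_eq yQ a x by metis
    qed
    obtain z where z: "z \<in> Q" "m z a = b" using right_div[OF a(1) b(1)] by blast
    show "\<exists>!x. x \<in> ?Q \<and> f (m x a) = b"
    proof (rule ex1I[of _ "f z"])
      show "f z \<in> ?Q \<and> f (m (f z) a) = b" using hom[of z a] a b z by auto
      fix y assume y: "y \<in> ?Q \<and> f (m y a) = b"
      then have yQ: "y \<in> Q" "f y = y" using f ff by auto
      have "R (m y a) (m z a)" using f_iff[of "m y a" "m z a"] y yQ a b z by simp
      then show "y = f z" using R_right' f_eq yQ a z by metis
    qed
  next
    show "f e \<in> ?Q" by simp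
    fix a assume "a \<in> ?Q"
    then have a: "a \<in> Q" "f a = a" using f ff by auto
    show "f (m (f e) a) = a" "f (m a (f e)) = a" using hom[of e a] hom[of a e] a by simp_all
  qed
  moreover have "loop_hom Q m ?Q ?m f" using hom by (auto simp: loop_hom_def)
  moreover have "{x \<in> Q. R e x} = {x \<in> Q. f x = f e}" using f_iff[of e] by auto metis+
  ultimately show ?thesis unfolding normal_subloop_def by blast
qed

text \<open>The translates of a block are the classes of an invariant equivalence, so the one
  containing \<open>e\<close> is a normal subloop, and the block is a translate of it.\<close>

lemma primitive:
  assumes simple: "simple_loop Q m e"
  shows "perm_primitive (Mlt Q m) Q"
  unfolding perm_primitive_def perm_transitive_def
proof (intro conjI ballI allI impI)
  fix x y assume "x \<in> Q" "y \<in> Q"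
  then show "\<exists>g\<in>carrier (Mlt Q m). g x = y" by (rule transitive)
next
  fix B assume B: "block (Mlt Q m) Q B"
  then have BQ: "B \<subseteq> Q" and "B \<noteq> {}"
    and blk: "\<And>g. g \<in> carrier (Mlt Q m) \<Longrightarrow> g ` B \<inter> B \<noteq> {} \<Longrightarrow> g ` B = B"
    unfolding block_def by blast+
  then obtain b where b: "b \<in> B" "b \<in> Q" by blast
  define R where "R x y \<longleftrightarrow> (\<exists>g\<in>carrier (Mlt Q m). x \<in> g ` B \<and> y \<in> g ` B)" for x y
  have mult_image: "(g \<otimes>\<^bsub>Mlt Q m\<^esub> h) ` B = g ` h ` B"
    if "g \<in> carrier (Mlt Q m)" "h \<in> carrier (Mlt Q m)" for g h
    using G.act_mult[OF that] BQ by (force simp: image_iff)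
  have inv_image: "(inv\<^bsub>Mlt Q m\<^esub> g) ` g ` B = B" "g ` (inv\<^bsub>Mlt Q m\<^esub> g) ` B = B" if "g \<in> carrier (Mlt Q m)" for g
    using G.act_inv[OF that] BQ by (force simp: image_iff)+
  \<comment> \<open>Translates sharing a point coincide: apply the block condition to the product of
    the inverse of \<open>g\<close> with \<open>h\<close>, then move back by
    \<open>g\<close>.\<close>
  have same: "g ` B = h ` B"
    if g: "g \<in> carrier (Mlt Q m)" and h: "h \<in> carrier (Mlt Q m)" and x: "x \<in> g ` B" "x \<in> h ` B" for g h x
  proof -
    let ?k = "inv\<^bsub>Mlt Q m\<^esub> g \<otimes>\<^bsub>Mlt Q m\<^esub> h"
    have k: "?k \<in> carrier (Mlt Q m)" using g h by simp
    have kB: "?k ` B = (inv\<^bsub>Mlt Q m\<^esub> g) ` h ` B" using mult_image g h by simp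
    have "(inv\<^bsub>Mlt Q m\<^esub> g) x \<in> ?k ` B" using x kB by blast
    moreover have "(inv\<^bsub>Mlt Q m\<^esub> g) x \<in> B" using x inv_image(1)[OF g] by blast
    ultimately have "?k ` B = B" using blk[OF k] by blast
    then have "g ` B = g ` ?k ` B" by simp
    also have "\<dots> = (g \<otimes>\<^bsub>Mlt Q m\<^esub> ?k) ` B" using mult_image[OF g k] by simp
    finally show ?thesis using g h by simp
  qed
  have "normal_subloop Q m e {x \<in> Q. R e x}"
  proof (rule invariant_equivalence_normal)
    fix x assume "x \<in> Q"
    then show "R x x" using transitive[OF b(2)] b(1) unfolding R_def by (metis imageI)
  next
    fix x y assume "R x y"
    then show "R y x" by (auto simp: R_def)
  next
    fix x y z assume "R x y" "R y z"
    then show "R x z" unfolding R_def using same by blast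
  next
    fix g x y assume g: "g \<in> carrier (Mlt Q m)" and "R x y"
    then obtain h where h: "h \<in> carrier (Mlt Q m)" "x \<in> h ` B" "y \<in> h ` B" by (auto simp: R_def)
    then have "g x \<in> (g \<otimes>\<^bsub>Mlt Q m\<^esub> h) ` B" "g y \<in> (g \<otimes>\<^bsub>Mlt Q m\<^esub> h) ` B"
      using mult_image g by auto
    then show "R (g x) (g y)" unfolding R_def using g h by blast
  qed
  then have N: "{x \<in> Q. R e x} = {e} \<or> {x \<in> Q. R e x} = Q" using simple by (simp add: simple_loop_def)
  obtain g where g: "g \<in> carrier (Mlt Q m)" "g b = e" using transitive[OF b(2) e_Q] by blast
  have eg: "e \<in> g ` B" using g b by blast
  have "{x \<in> Q. R e x} = g ` B"
  proof
    show "{x \<in> Q. R e x} \<subseteq> g ` B" unfolding R_def using same[OF g(1)] eg by blast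
    show "g ` B \<subseteq> {x \<in> Q. R e x}" unfolding R_def using eg g BQ by auto
  qed
  then have "g ` B = {e} \<or> g ` B = Q" using N by simp
  then show "card B = 1 \<or> B = Q"
  proof
    assume "g ` B = {e}"
    then have "B = (inv\<^bsub>Mlt Q m\<^esub> g) ` {e}" using inv_image(1)[OF g(1)] by simp
    then show ?thesis by simp
  next
    assume "g ` B = Q"
    then have "B = (inv\<^bsub>Mlt Q m\<^esub> g) ` Q" using inv_image(1)[OF g(1)] by simp
    moreover have "x \<in> (inv\<^bsub>Mlt Q m\<^esub> g) ` Q" if "x \<in> Q" for x
      using G.act_inv(1)[OF g(1) that] g that by (metis G.act_closed imageI)
    ultimately show ?thesis using BQ by blast
  qed
qed

text \<open>The orbits of the center \<open>Z\<close> of \<open>N\<close> form an invariant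
  equivalence, so simplicity leaves only the cases that \<open>Z\<close> fixes \<open>e\<close> or
  is transitive.\<close>

lemma affine_of_normal_two_subgroup:
  assumes simple: "simple_loop Q m e"
    and N: "N \<lhd> Mlt Q m" "two_subgroup (Mlt Q m) N" "N \<noteq> {\<one>\<^bsub>Mlt Q m\<^esub>}"
  shows "affine_type (Mlt Q m) Q"
proof -
  let ?G = "Mlt Q m"
  let ?m = "monoid.mult ?G" and ?i = "m_inv ?G" and ?one = "one ?G"
  define Z where "Z = {z \<in> N. \<forall>k\<in>N. ?m k z = ?m z k}"
  have sN: "subgroup N ?G" using N by (simp add: two_subgroup_def)
  note Nc = subgroup.mem_carrier[OF sN]
  have Zc: "z \<in> carrier ?G" if "z \<in> Z" for z using that Nc by (simp add: Z_def)
  have Nconj: "?m (?m g x) (?i g) \<in> N" if "g \<in> carrier ?G" "x \<in> N" for g x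
    using N(1) that G.normal_inv_iff by blast
  have sZ: "subgroup Z ?G"
  proof (rule G.subgroupI)
    show "Z \<subseteq> carrier ?G" using Zc by blast
    show "Z \<noteq> {}" using subgroup.one_closed[OF sN] Nc by (auto simp: Z_def intro!: exI[of _ ?one])
  next
    fix a assume a: "a \<in> Z"
    then show "?i a \<in> Z"
      using subgroup.m_inv_closed[OF sN] G.commute_inv[OF _ Zc[OF a]] Nc by (auto simp: Z_def)
  next
    fix a b assume ab: "a \<in> Z" "b \<in> Z"
    have "?m k (?m a b) = ?m (?m a b) k" if k: "k \<in> N" for k
      by (rule G.commute_mult[OF Nc[OF k] Zc[OF ab(1)] Zc[OF ab(2)]]) (use ab k in \<open>simp_all add: Z_def\<close>)
    moreover have "?m a b \<in> N"
      by (rule subgroup.m_closed[OF sN]) (use ab in \<open>simp_all add: Z_def\<close>)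
    ultimately show "?m a b \<in> Z" by (simp add: Z_def)
  qed
  have Zconj: "?m (?m g z) (?i g) \<in> Z" if g: "g \<in> carrier ?G" and z: "z \<in> Z" for g z
  proof -
    have zN: "z \<in> N" using z by (simp add: Z_def)
    have "?m k (?m (?m g z) (?i g)) = ?m (?m (?m g z) (?i g)) k" if k: "k \<in> N" for k
    proof -
      \<comment> \<open>Writing \<open>k\<close> as a conjugate of \<open>k'\<close> by
        \<open>g\<close> reduces the claim to commutation of \<open>z\<close> with
        \<open>k'\<close>.\<close>
      define k' where "k' = ?m (?m (?i g) k) g"
      have k': "k' \<in> N" using Nconj[of "?i g" k] g k by (simp add: k'_def)
      have kk: "k = ?m (?m g k') (?i g)" using g Nc[OF k] by (simp add: k'_def G.m_assoc)
      have "?m k' z = ?m z k'" using z k' by (simp add: Z_def)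
      then have "?m g (?m (?m k' z) (?i g)) = ?m g (?m (?m z k') (?i g))" by simp
      then show ?thesis using g Nc[OF k'] Zc[OF z] by (simp add: kk G.m_assoc)
    qed
    then show ?thesis using Nconj[OF g zN] by (simp add: Z_def)
  qed
  have nZ: "Z \<lhd> ?G" using sZ Zconj G.normal_inv_iff by blast
  have comm: "\<forall>a\<in>Z. \<forall>b\<in>Z. ?m a b = ?m b a" unfolding Z_def by blast
  obtain z0 where z0: "z0 \<in> Z" "z0 \<noteq> ?one"
    using G.two_subgroup_center[OF N(2,3)] by (auto simp: Z_def)
  define R where "R x y \<longleftrightarrow> (\<exists>z\<in>Z. z x = y)" for x y
  have "normal_subloop Q m e {x \<in> Q. R e x}"
  proof (rule invariant_equivalence_normal)
    fix x assume "x \<in> Q"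
    then show "R x x" unfolding R_def using subgroup.one_closed[OF sZ] by (metis G.act_one)
  next
    fix x y assume x: "x \<in> Q" and "R x y"
    then obtain z where "z \<in> Z" "z x = y" by (auto simp: R_def)
    then show "R y x" unfolding R_def using subgroup.m_inv_closed[OF sZ] G.act_inv(1)[OF Zc x] by metis
  next
    fix x y z assume x: "x \<in> Q" and "R x y" "R y z"
    then obtain a b where "a \<in> Z" "a x = y" "b \<in> Z" "b y = z" by (auto simp: R_def)
    then show "R x z" unfolding R_def
      using subgroup.m_closed[OF sZ, of b a] G.act_mult[OF Zc[of b] Zc[of a] x] by metis
  next
    fix g x y assume g: "g \<in> carrier ?G" and x: "x \<in> Q" and "R x y"
    then obtain z where z: "z \<in> Z" "z x = y" by (auto simp: R_def)
    have "(?m (?m g z) (?i g)) (g x) = g y" using g x z Zc[OF z(1)] by simp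
    then show "R (g x) (g y)" unfolding R_def using Zconj[OF g z(1)] by blast
  qed
  then have dich: "{x \<in> Q. R e x} = {e} \<or> {x \<in> Q. R e x} = Q"
    using simple by (simp add: simple_loop_def)
  have "{x \<in> Q. R e x} \<noteq> {e}"
  proof
    assume e1: "{x \<in> Q. R e x} = {e}"
    have fixe: "z e = e" if z: "z \<in> Z" for z
    proof -
      have "z e \<in> {x \<in> Q. R e x}" using z Zc[OF z] by (auto simp: R_def)
      then show ?thesis using e1 by simp
    qed
    \<comment> \<open>Point stabilizers are conjugate by transitivity, so a normal subgroup fixing
      \<open>e\<close> fixes every point.\<close>
    have "z0 = ?one"
    proof (rule G.act_ext)
      fix x assume x: "x \<in> Q"
      obtain g where g: "g \<in> carrier ?G" "g e = x" using transitive[OF e_Q x] by blast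
      let ?z = "?m (?m (?i g) z0) g"
      have "?z \<in> Z" using Zconj[of "?i g" z0] g z0 by simp
      then have "?z e = e" by (rule fixe)
      then have "(?i g) (z0 x) = e" using g Zc[OF z0(1)] x by simp
      then have "z0 x = g e" using G.act_inv(2)[of g "z0 x"] g Zc[OF z0(1)] x by simp
      then show "z0 x = ?one x" using g x by simp
    qed (use Zc[OF z0(1)] in simp_all)
    then show False using z0 by simp
  qed
  then have orbit: "\<exists>z\<in>Z. z e = x" if "x \<in> Q" for x using dich that by (auto simp: R_def)
  have trans: "\<exists>z\<in>Z. z x = y" if x: "x \<in> Q" and y: "y \<in> Q" for x y
  proof -
    obtain a b where a: "a \<in> Z" "a e = x" and b: "b \<in> Z" "b e = y" using orbit x y by metis
    have "(?m b (?i a)) x = y" using a b Zc[OF a(1)] Zc[OF b(1)] x G.act_inv(1)[of a e] by simp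
    then show ?thesis using subgroup.m_closed[OF sZ b(1) subgroup.m_inv_closed[OF sZ a(1)]] by blast
  qed
  have "perm_regular ?G Z Q"
    unfolding perm_regular_def
  proof (intro ballI)
    fix x y assume x: "x \<in> Q" and y: "y \<in> Q"
    obtain a where a: "a \<in> Z" "a x = y" using trans[OF x y] by blast
    show "\<exists>!a. a \<in> Z \<and> a x = y"
    proof (rule ex1I[of _ a])
      show "a \<in> Z \<and> a x = y" using a by simp
      fix b assume b: "b \<in> Z \<and> b x = y"
      show "b = a"
      proof (rule G.act_ext)
        fix w assume w: "w \<in> Q"
        obtain d where d: "d \<in> Z" "d x = w" using trans[OF x w] by blast
        \<comment> \<open>\<open>a\<close> and \<open>b\<close> agree at \<open>x\<close> and
          commute with \<open>d\<close>, so they agree at \<open>w = d x\<close>.\<close>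
        have "b (d x) = d (b x)" "a (d x) = d (a x)"
          using G.act_mult[OF Zc Zc x] comm a b d by metis+
        then show "b w = a w" using a b d by simp
      qed (use a b Zc in auto)
    qed
  qed
  then show ?thesis unfolding affine_type_def using nZ comm by blast
qed

end

section \<open>The inversion map\<close>

locale automorphic_two = nonassoc_loop +
  fixes n :: nat
  assumes automorphic: "automorphic_loop Q m e"
    and fin: "finite Q" and card: "card Q = 2 ^ n"
begin

lemma finite_M: "finite (carrier (Mlt Q m))"
  using finite_Bij[OF fin] subgroup.subset[OF M_subgroup] by (auto simp: Mlt_simps BijGroup_simps intro: finite_subset)

lemma inner_aut: "\<lbrakk>\<phi> \<in> carrier (Mlt Q m); \<phi> e = e; x \<in> Q; y \<in> Q\<rbrakk> \<Longrightarrow> \<phi> (m x y) = m (\<phi> x) (\<phi> y)"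
  using automorphic by (simp add: automorphic_loop_def Inn_def)

abbreviation L where "L \<equiv> Ltr Q m"
abbreviation R where "R \<equiv> Rtr Q m"
abbreviation G where "G \<equiv> Mlt Q m"

text \<open>The right inverse map, made extensional so that it can be an element of
  \<open>BijGroup Q\<close>.\<close>

definition J where "J = (\<lambda>x\<in>Q. (inv\<^bsub>G\<^esub> (L x)) e)"

lemma J_closed [simp]: "x \<in> Q \<Longrightarrow> J x \<in> Q"
  by (simp add: J_def)

lemma J_right [simp]:
  assumes x: "x \<in> Q"
  shows "m x (J x) = e"
proof -
  have "m x ((inv\<^bsub>G\<^esub> (L x)) e) = e"
    using G.act_inv(2)[of "L x" e] Ltr_apply[of "(inv\<^bsub>G\<^esub> (L x)) e" x] x
    by (metis G.act_closed G.inv_closed Ltr_closed e_Q)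
  then show ?thesis using x by (simp add: J_def)
qed

text \<open>\<open>\<tau>\<close> is an inner mapping fixing \<open>x\<close>, so it fixes the right
  inverse \<open>J x\<close>; its defining equation at \<open>J x\<close> then reads
  \<open>m (J x) x = m x (J x)\<close>.\<close>

lemma J_left [simp]:
  assumes x: "x \<in> Q"
  shows "m (J x) x = e"
proof -
  define \<tau> where "\<tau> = inv\<^bsub>G\<^esub> (R x) \<otimes>\<^bsub>G\<^esub> L x"
  have \<tau>: "\<tau> \<in> carrier G" using x by (simp add: \<tau>_def)
  have Rx: "R x (\<tau> y) = L x y" if "y \<in> Q" for y
    using x that G.act_inv(2)[of "R x" "L x y"] by (simp add: \<tau>_def)
  have \<tau>R: "m (\<tau> y) x = m x y" if "y \<in> Q" for y using Rx[OF that] x \<tau> that by simp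
  have "m (\<tau> e) x = m e x" using \<tau>R[of e] x by simp
  then have \<tau>e: "\<tau> e = e" using right_cancel[of "\<tau> e" x e] x \<tau> by simp
  have \<tau>x: "\<tau> x = x" using \<tau>R[OF x] right_cancel[of "\<tau> x" x x] x \<tau> by simp
  have "m x (\<tau> (J x)) = m x (J x)" using inner_aut[OF \<tau> \<tau>e x, of "J x"] \<tau>x \<tau>e x by simp
  then have "\<tau> (J x) = J x" using left_cancel[of x "\<tau> (J x)" "J x"] x \<tau> by simp
  then show ?thesis using \<tau>R[of "J x"] x by simp
qed

lemma J_unique: "\<lbrakk>x \<in> Q; y \<in> Q; m x y = e\<rbrakk> \<Longrightarrow> y = J x"
  using left_cancel[of x y "J x"] by simp

lemma J_J [simp]: "x \<in> Q \<Longrightarrow> J (J x) = x"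
  using J_unique[of "J x" x] by simp

lemma J_e [simp]: "J e = e"
  using J_unique[of e e] by simp

lemma inner_J: "\<lbrakk>\<phi> \<in> carrier G; \<phi> e = e; x \<in> Q\<rbrakk> \<Longrightarrow> \<phi> (J x) = J (\<phi> x)"
  using inner_aut[of \<phi> x "J x"] by (intro J_unique) simp_all

text \<open>The inner mapping \<open>q\<close> solves \<open>m (q z) u = m x (m z y)\<close>. It
  takes \<open>x\<close>, \<open>t\<close>, \<open>y\<close> to \<open>x\<close>,
  \<open>J u\<close>, \<open>J w\<close>; preserving products and inverses, it carries
  \<open>m t y = J x\<close> to the claim.\<close>

lemma J_antiautomorphism:
  assumes w: "w \<in> Q" and u: "u \<in> Q"
  shows "J (m w u) = m (J u) (J w)"
proof -
  define x where "x = m w u"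
  have x: "x \<in> Q" using w u by (simp add: x_def)
  obtain y where y: "y \<in> Q" "m x y = u" using left_div[OF x u] by blast
  obtain t where t: "t \<in> Q" "m t y = J x" using right_div[of y "J x"] x y by auto
  define q where "q = inv\<^bsub>G\<^esub> (R u) \<otimes>\<^bsub>G\<^esub> (L x \<otimes>\<^bsub>G\<^esub> R y)"
  have q: "q \<in> carrier G" using x y u by (simp add: q_def)
  have "R u (q z) = m x (m z y)" if "z \<in> Q" for z
    using x y u that G.act_inv(2)[of "R u" "m x (m z y)"] by (simp add: q_def)
  then have qm: "m (q z) u = m x (m z y)" if "z \<in> Q" for z using that q u by simp
  have qI: "q z = z'" if "z \<in> Q" "z' \<in> Q" "m x (m z y) = m z' u" for z z'
    using right_cancel[of "q z" u z'] qm[of z] that q u by simp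
  have qe: "q e = e" using qI[of e e] x y u by simp
  have qx: "q x = x" using qI[of x x] x y by simp
  have "q (J y) = w" using qI[of "J y" w] x y w by (simp add: x_def)
  then have "J (q y) = w" using inner_J[OF q qe y(1)] by simp
  then have qy: "q y = J w" using J_J[of "q y"] q y by simp
  have qt: "q t = J u" using qI[of t "J u"] x t u by simp
  have "q (J x) = m (q t) (q y)" using inner_aut[OF q qe t(1) y(1)] t by simp
  then show ?thesis using inner_J[OF q qe x] qx qy qt by (simp add: x_def)
qed

section \<open>The symmetric group on \<open>Q\<close> and the extension of the multiplication group
  by \<open>J\<close>\<close>

definition B where "B = BijGroup Q"

interpretation B: perm_group B Q unfolding B_def by (rule perm_group_BijGroup)

lemma G_B:
  "carrier G \<subseteq> carrier B" "subgroup (carrier G) B"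
  "monoid.mult G = monoid.mult B" "one G = one B"
  "g \<in> carrier G \<Longrightarrow> inv\<^bsub>G\<^esub> g = inv\<^bsub>B\<^esub> g"
  using Mlt_simps M_subgroup subgroup.subset[OF M_subgroup] by (simp_all add: B_def)

lemma J_B [simp]: "J \<in> carrier B"
proof -
  have "bij_betw J Q Q" by (rule bij_betwI[where g = J]) auto
  then show ?thesis by (simp add: B_def BijGroup_simps Bij_def J_def)
qed

lemma L_B [simp]: "x \<in> Q \<Longrightarrow> L x \<in> carrier B"
  and R_B [simp]: "x \<in> Q \<Longrightarrow> R x \<in> carrier B"
  using G_B(1) by auto

lemma J_square: "J \<otimes>\<^bsub>B\<^esub> J = \<one>\<^bsub>B\<^esub>"
  by (rule B.act_ext) simp_all

lemma J_inv [simp]: "inv\<^bsub>B\<^esub> J = J"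
  using J_square by (simp add: B.inv_equality)

lemma J_L: "x \<in> Q \<Longrightarrow> J \<otimes>\<^bsub>B\<^esub> L x \<otimes>\<^bsub>B\<^esub> J = R (J x)"
  by (rule B.act_ext) (simp_all add: J_antiautomorphism)

lemma J_R: "x \<in> Q \<Longrightarrow> J \<otimes>\<^bsub>B\<^esub> R x \<otimes>\<^bsub>B\<^esub> J = L (J x)"
  by (rule B.act_ext) (simp_all add: J_antiautomorphism)

lemma J_nrm: "J \<in> nrm B (carrier G)"
proof -
  have "J \<in> nrm B T"
    unfolding nrm_def T_def by (auto simp: J_L J_R)
  then show ?thesis
    using B.nrm_generate[of T] T_carrier by (auto simp: B_def Mlt_simps M_def)
qed

text \<open>As \<open>J\<close> normalizes the multiplication group, this set product is already a
  subgroup, and each element is \<open>h\<close> or \<open>h\<close> times \<open>J\<close>.\<close>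

definition \<Gamma> where "\<Gamma> = carrier G <#>\<^bsub>B\<^esub> {\<one>\<^bsub>B\<^esub>, J}"

lemma subgroup_J: "subgroup {\<one>\<^bsub>B\<^esub>, J} B"
  by (rule B.subgroupI) (auto simp: J_square)

lemma \<Gamma>_subgroup: "subgroup \<Gamma> B"
  unfolding \<Gamma>_def
proof (rule B.subgroup_set_mult[OF G_B(2) subgroup_J])
  show "{\<one>\<^bsub>B\<^esub>, J} \<subseteq> nrm B (carrier G)"
    using J_nrm B.subgroup_nrm[OF G_B(1)] subgroup.one_closed by auto
qed

lemma G_\<Gamma>: "carrier G \<subseteq> \<Gamma>"
proof
  fix g assume g: "g \<in> carrier G"
  then have "g = g \<otimes>\<^bsub>B\<^esub> \<one>\<^bsub>B\<^esub>" using G_B(1) by (intro B.r_one[symmetric]) blast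
  then show "g \<in> \<Gamma>" unfolding \<Gamma>_def set_mult_def using g by blast
qed

lemma J_\<Gamma>: "J \<in> \<Gamma>"
proof -
  have "J = \<one>\<^bsub>B\<^esub> \<otimes>\<^bsub>B\<^esub> J" by simp
  then show ?thesis unfolding \<Gamma>_def set_mult_def using subgroup.one_closed[OF G_B(2)] by blast
qed

text \<open>Since \<open>J\<close> fixes \<open>e\<close>, the factor \<open>h\<close> from the
  multiplication group is an inner mapping, and \<open>inner_J\<close> applies.\<close>

lemma stabilizer_commutes_J:
  assumes g: "g \<in> \<Gamma>" "g e = e"
  shows "g \<otimes>\<^bsub>B\<^esub> J = J \<otimes>\<^bsub>B\<^esub> g"
proof -
  obtain h j where h: "h \<in> carrier G" and j: "j \<in> {\<one>\<^bsub>B\<^esub>, J}" and gh: "g = h \<otimes>\<^bsub>B\<^esub> j"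
    using g(1) by (auto simp: \<Gamma>_def set_mult_def)
  have hB: "h \<in> carrier B" using h G_B(1) by blast
  have jB: "j \<in> carrier B" and je: "j e = e" and jJ: "J \<otimes>\<^bsub>B\<^esub> j = j \<otimes>\<^bsub>B\<^esub> J" using j by auto
  have he: "h e = e" using g(2) gh hB jB je by simp
  have hJ: "J \<otimes>\<^bsub>B\<^esub> h = h \<otimes>\<^bsub>B\<^esub> J"
    by (rule B.act_ext) (use hB inner_J[OF h he] in simp_all)
  show ?thesis unfolding gh using B.commute_mult[OF J_B hB jB hJ jJ] by simp
qed

lemma card_orbit_stabilizer:
  assumes K: "subgroup K B" and x: "x \<in> Q"
  shows "card ((\<lambda>g. g x) ` K) * card {g \<in> K. g x = x} = card K"
proof -
  note Kc = subgroup.mem_carrier[OF K]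
  have act: "group_action (B\<lparr>carrier := K\<rparr>) Q (\<lambda>g. restrict g Q)"
    by (rule B.subgroup_action[OF K]) (use Kc in simp_all)
  have "orbit (B\<lparr>carrier := K\<rparr>) (\<lambda>g. restrict g Q) x = (\<lambda>g. g x) ` K"
    "stabilizer (B\<lparr>carrier := K\<rparr>) (\<lambda>g. restrict g Q) x = {g \<in> K. g x = x}"
    using x by (auto simp: orbit_def stabilizer_def)
  then show ?thesis
    using group_action.orbit_stabilizer_theorem[OF act x] by (simp add: order_def)
qed

text \<open>A Sylow 2-subgroup \<open>S\<close> of \<open>\<Gamma>\<close> has an odd number of
  cosets, so \<open>J\<close> fixes some coset of \<open>d\<close>, and the conjugate
  \<open>I\<close> of \<open>J\<close> by \<open>d\<close> lies in \<open>S\<close>. The stabilizer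
  of \<open>x = d e\<close> commutes with \<open>I\<close>. As \<open>S\<close> is transitive, every
  conjugate of \<open>I\<close> is a conjugate by an element of \<open>S\<close>, hence lies in
  \<open>S\<close>.\<close>

lemma inversion_normal_two_subgroup:
  "\<exists>N. two_subgroup B N \<and> J \<in> N \<and> \<Gamma> \<subseteq> nrm B N"
proof -
  have fin\<Gamma>: "finite \<Gamma>"
    using finite_Bij[OF fin] subgroup.subset[OF \<Gamma>_subgroup]
    by (auto simp: B_def BijGroup_simps intro: finite_subset)
  note \<Gamma>c = subgroup.mem_carrier[OF \<Gamma>_subgroup]
  interpret D: group "B\<lparr>carrier := \<Gamma>\<rparr>"
    by (rule subgroup.subgroup_is_group[OF \<Gamma>_subgroup B.group_axioms])
  have "card \<Gamma> \<noteq> 0" using fin\<Gamma> J_\<Gamma> by auto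
  define a where "a = multiplicity 2 (card \<Gamma>)"
  obtain b where ab: "card \<Gamma> = 2 ^ a * b" "odd b"
    using multiplicity_decompose'[of "card \<Gamma>" "2::nat"] \<open>card \<Gamma> \<noteq> 0\<close> unfolding a_def by force
  obtain S where S: "subgroup S (B\<lparr>carrier := \<Gamma>\<rparr>)" "card S = 2 ^ a"
    using sylow_thm[OF two_is_prime_nat D.group_axioms, of a b] ab fin\<Gamma> by (auto simp: order_def)
  have S\<Gamma>: "S \<subseteq> \<Gamma>" using subgroup.subset[OF S(1)] by simp
  have sS: "subgroup S B" using S(1) B.incl_subgroup[OF \<Gamma>_subgroup] by blast
  note Sc = subgroup.mem_carrier[OF sS]
  define W where "W = (\<lambda>d. S #>\<^bsub>B\<^esub> d) ` \<Gamma>"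
  have "W = rcosets\<^bsub>B\<lparr>carrier := \<Gamma>\<rparr>\<^esub> S"
    by (auto simp: W_def RCOSETS_def r_coset_def)
  then have "card W * 2 ^ a = 2 ^ a * b"
    using D.lagrange[OF S(1)] S ab by (simp add: order_def)
  then have "odd (card W)" using ab by simp
  have Wsub: "Y \<subseteq> carrier B" if "Y \<in> W" for Y
    using that \<Gamma>c Sc by (auto simp: W_def r_coset_def)
  define F where "F = {Y \<in> W. \<forall>g\<in>{\<one>\<^bsub>B\<^esub>, J}. Y #>\<^bsub>B\<^esub> inv\<^bsub>B\<^esub> g = Y}"
  \<comment> \<open>\<open>J\<close> may be the identity, so this group has order 1 or 2.\<close>
  have two: "\<exists>k. card {\<one>\<^bsub>B\<^esub>, J} = 2 ^ k"
    by (cases "J = \<one>\<^bsub>B\<^esub>") (auto intro: exI[of _ 0] exI[of _ 1])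
  then obtain k where k: "card {\<one>\<^bsub>B\<^esub>, J} = 2 ^ k" by blast
  have "card W mod 2 = card F mod 2"
    unfolding F_def
  proof (rule B.prime_power_fixed_points[OF subgroup_J two_is_prime_nat k])
    show "finite W" using fin\<Gamma> by (simp add: W_def)
  next
    fix g Y assume g: "g \<in> {\<one>\<^bsub>B\<^esub>, J}" and "Y \<in> W"
    then obtain d where d: "d \<in> \<Gamma>" "Y = S #>\<^bsub>B\<^esub> d" by (auto simp: W_def)
    have g\<Gamma>: "g \<in> \<Gamma>" using g J_\<Gamma> subgroup.one_closed[OF \<Gamma>_subgroup] by auto
    have "Y #>\<^bsub>B\<^esub> inv\<^bsub>B\<^esub> g = S #>\<^bsub>B\<^esub> (d \<otimes>\<^bsub>B\<^esub> inv\<^bsub>B\<^esub> g)"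
      using d g\<Gamma> \<Gamma>c subgroup.subset[OF sS] by (simp add: B.coset_mult_assoc)
    moreover have "d \<otimes>\<^bsub>B\<^esub> inv\<^bsub>B\<^esub> g \<in> \<Gamma>"
      using d g\<Gamma> subgroup.m_closed[OF \<Gamma>_subgroup] subgroup.m_inv_closed[OF \<Gamma>_subgroup] by simp
    ultimately show "Y #>\<^bsub>B\<^esub> inv\<^bsub>B\<^esub> g \<in> W" by (simp add: W_def)
  next
    fix Y assume "Y \<in> W"
    then show "Y #>\<^bsub>B\<^esub> inv\<^bsub>B\<^esub> \<one>\<^bsub>B\<^esub> = Y" using Wsub by simp
  next
    fix g h Y assume "g \<in> {\<one>\<^bsub>B\<^esub>, J}" "h \<in> {\<one>\<^bsub>B\<^esub>, J}" "Y \<in> W"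
    moreover from this have "g \<in> carrier B" "h \<in> carrier B" by auto
    ultimately show "Y #>\<^bsub>B\<^esub> inv\<^bsub>B\<^esub> (g \<otimes>\<^bsub>B\<^esub> h) = Y #>\<^bsub>B\<^esub> inv\<^bsub>B\<^esub> h #>\<^bsub>B\<^esub> inv\<^bsub>B\<^esub> g"
      using Wsub[of Y] by (simp add: B.inv_mult_group B.coset_mult_assoc)
  qed
  then have "card F \<noteq> 0" using \<open>odd (card W)\<close> by (metis even_iff_mod_2_eq_zero mod_0)
  then obtain Y where "Y \<in> F" by fastforce
  then obtain d where d: "d \<in> \<Gamma>" "S #>\<^bsub>B\<^esub> d #>\<^bsub>B\<^esub> J = S #>\<^bsub>B\<^esub> d" by (auto simp: F_def W_def)
  have dB: "d \<in> carrier B" using d \<Gamma>c by blast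
  define I where "I = d \<otimes>\<^bsub>B\<^esub> J \<otimes>\<^bsub>B\<^esub> inv\<^bsub>B\<^esub> d"
  have IB: "I \<in> carrier B" using dB by (simp add: I_def)
  have IS: "I \<in> S"
  proof -
    have "S #>\<^bsub>B\<^esub> (d \<otimes>\<^bsub>B\<^esub> J) = S #>\<^bsub>B\<^esub> d"
      using d(2) dB subgroup.subset[OF sS] by (simp add: B.coset_mult_assoc)
    then have "d \<otimes>\<^bsub>B\<^esub> J \<in> S #>\<^bsub>B\<^esub> d" using B.rcos_self[OF _ sS, of "d \<otimes>\<^bsub>B\<^esub> J"] dB by simp
    then obtain h where "h \<in> S" "d \<otimes>\<^bsub>B\<^esub> J = h \<otimes>\<^bsub>B\<^esub> d" by (auto simp: r_coset_def)
    then show ?thesis using dB Sc by (simp add: I_def B.m_assoc)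
  qed
  define x where "x = d e"
  have x: "x \<in> Q" using dB by (simp add: x_def)
  have stab: "g \<otimes>\<^bsub>B\<^esub> I = I \<otimes>\<^bsub>B\<^esub> g" if g: "g \<in> \<Gamma>" "g x = x" for g
  proof -
    define h where "h = inv\<^bsub>B\<^esub> d \<otimes>\<^bsub>B\<^esub> g \<otimes>\<^bsub>B\<^esub> d"
    have gB: "g \<in> carrier B" using g \<Gamma>c by blast
    have hB: "h \<in> carrier B" using gB dB by (simp add: h_def)
    have h\<Gamma>: "h \<in> \<Gamma>" unfolding h_def
      using d g subgroup.m_closed[OF \<Gamma>_subgroup] subgroup.m_inv_closed[OF \<Gamma>_subgroup] by simp
    have "h e = e" using g(2) gB dB by (simp add: h_def x_def)
    then have "h \<otimes>\<^bsub>B\<^esub> J = J \<otimes>\<^bsub>B\<^esub> h" using stabilizer_commutes_J h\<Gamma> by blast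
    then have "d \<otimes>\<^bsub>B\<^esub> (h \<otimes>\<^bsub>B\<^esub> J) \<otimes>\<^bsub>B\<^esub> inv\<^bsub>B\<^esub> d = d \<otimes>\<^bsub>B\<^esub> (J \<otimes>\<^bsub>B\<^esub> h) \<otimes>\<^bsub>B\<^esub> inv\<^bsub>B\<^esub> d" by simp
    then show ?thesis using gB dB by (simp add: h_def I_def B.m_assoc)
  qed
  have trans: "(\<lambda>g. g x) ` S = Q"
  proof -
    have \<Gamma>x: "(\<lambda>g. g x) ` \<Gamma> = Q"
    proof
      show "(\<lambda>g. g x) ` \<Gamma> \<subseteq> Q" using \<Gamma>c x by auto
      show "Q \<subseteq> (\<lambda>g. g x) ` \<Gamma>" using transitive[OF x] G_\<Gamma> by blast
    qed
    \<comment> \<open>Here \<open>card ?E\<close> is a power of 2 dividing \<open>card ?D\<close>.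
      Since \<open>b\<close> is odd, \<open>2 ^ n * card ?E\<close> divides \<open>2 ^ a\<close>, so
      the orbit of \<open>x\<close> under \<open>S\<close> has at least \<open>2 ^ n\<close>
      points.\<close>
    let ?D = "{g \<in> \<Gamma>. g x = x}" and ?E = "{g \<in> S. g x = x}"
    have cD: "2 ^ n * card ?D = 2 ^ a * b"
      using card_orbit_stabilizer[OF \<Gamma>_subgroup x] \<Gamma>x card ab by simp
    have cE: "card ((\<lambda>g. g x) ` S) * card ?E = 2 ^ a"
      using card_orbit_stabilizer[OF sS x] S by simp
    have fixsub: "subgroup {g \<in> K. g x = x} B" if K: "subgroup K B" for K
    proof (rule B.subgroupI)
      note Kc = subgroup.mem_carrier[OF K]
      show "{g \<in> K. g x = x} \<subseteq> carrier B" using Kc by auto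
      show "{g \<in> K. g x = x} \<noteq> {}" using subgroup.one_closed[OF K] x by (auto intro!: exI[of _ "\<one>\<^bsub>B\<^esub>"])
      show "inv\<^bsub>B\<^esub> g \<in> {g \<in> K. g x = x}" if "g \<in> {g \<in> K. g x = x}" for g
        using that subgroup.m_inv_closed[OF K] B.act_inv_fix[OF Kc x] by auto
      show "g \<otimes>\<^bsub>B\<^esub> h \<in> {g \<in> K. g x = x}" if "g \<in> {g \<in> K. g x = x}" "h \<in> {g \<in> K. g x = x}" for g h
        using that subgroup.m_closed[OF K] B.act_mult[OF Kc Kc x] by auto
    qed
    have "card ?E dvd card ?D"
      by (rule B.card_subgroup_dvd[OF fixsub[OF \<Gamma>_subgroup] fixsub[OF sS]]) (use S\<Gamma> in auto)
    then have "2 ^ n * card ?E dvd 2 ^ n * card ?D" by (rule mult_dvd_mono[OF dvd_refl])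
    then have dvd: "2 ^ n * card ?E dvd 2 ^ a * b" unfolding cD .
    have "card ?E dvd 2 ^ a" unfolding cE[symmetric] by (rule dvd_triv_right)
    then obtain i where i: "card ?E = 2 ^ i" using divides_primepow_nat[OF two_is_prime_nat] by blast
    have "coprime (2 ^ (n + i)) b" using ab(2) by simp
    moreover have "2 ^ (n + i) dvd 2 ^ a * b" using dvd unfolding i power_add .
    ultimately have "2 ^ (n + i) dvd (2::nat) ^ a" by (simp add: coprime_dvd_mult_left_iff)
    then have "(2::nat) ^ (n + i) \<le> 2 ^ a" by (rule dvd_imp_le) simp
    then have "2 ^ n * card ?E \<le> card ((\<lambda>g. g x) ` S) * card ?E" unfolding cE unfolding i power_add .
    then have "card Q \<le> card ((\<lambda>g. g x) ` S)" using i card by simp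
    moreover have "(\<lambda>g. g x) ` S \<subseteq> Q" using Sc x by auto
    ultimately show ?thesis using fin card_seteq by blast
  qed
  define C where "C = (\<lambda>g. g \<otimes>\<^bsub>B\<^esub> J \<otimes>\<^bsub>B\<^esub> inv\<^bsub>B\<^esub> g) ` \<Gamma>"
  have CS: "C \<subseteq> S"
  proof
    fix t assume "t \<in> C"
    then obtain g where g: "g \<in> \<Gamma>" "t = g \<otimes>\<^bsub>B\<^esub> J \<otimes>\<^bsub>B\<^esub> inv\<^bsub>B\<^esub> g" by (auto simp: C_def)
    define h where "h = g \<otimes>\<^bsub>B\<^esub> inv\<^bsub>B\<^esub> d"
    have gB: "g \<in> carrier B" using g \<Gamma>c by blast
    have h: "h \<in> \<Gamma>" unfolding h_def
      using d g subgroup.m_closed[OF \<Gamma>_subgroup] subgroup.m_inv_closed[OF \<Gamma>_subgroup] by simp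
    have hB: "h \<in> carrier B" using h \<Gamma>c by blast
    have t: "t = h \<otimes>\<^bsub>B\<^esub> I \<otimes>\<^bsub>B\<^esub> inv\<^bsub>B\<^esub> h"
      using gB dB by (simp add: g h_def I_def B.m_assoc B.inv_mult_group)
    \<comment> \<open>An element \<open>s\<close> of \<open>S\<close> corrects \<open>h\<close> to a
      \<open>k\<close> fixing \<open>x\<close>; as \<open>k\<close> commutes with \<open>I\<close>,
      conjugating \<open>I\<close> by \<open>h\<close> or by \<open>s\<close> gives the
      same.\<close>
    have "h x \<in> (\<lambda>g. g x) ` S" using trans hB x by simp
    then obtain s where s: "s \<in> S" "s x = h x" by auto
    have sB: "s \<in> carrier B" using s Sc by blast
    define k where "k = inv\<^bsub>B\<^esub> s \<otimes>\<^bsub>B\<^esub> h"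
    have kB: "k \<in> carrier B" using sB hB by (simp add: k_def)
    have k\<Gamma>: "k \<in> \<Gamma>" unfolding k_def
      using subsetD[OF S\<Gamma> s(1)] h subgroup.m_closed[OF \<Gamma>_subgroup] subgroup.m_inv_closed[OF \<Gamma>_subgroup] by simp
    have "k x = x" using s sB hB x B.act_inv(1)[OF sB x] by (simp add: k_def)
    then have kI: "k \<otimes>\<^bsub>B\<^esub> I = I \<otimes>\<^bsub>B\<^esub> k" using stab k\<Gamma> by blast
    have hs: "h = s \<otimes>\<^bsub>B\<^esub> k" using sB hB by (simp add: k_def)
    have "t = s \<otimes>\<^bsub>B\<^esub> (k \<otimes>\<^bsub>B\<^esub> I) \<otimes>\<^bsub>B\<^esub> inv\<^bsub>B\<^esub> k \<otimes>\<^bsub>B\<^esub> inv\<^bsub>B\<^esub> s"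
      unfolding t hs using sB kB IB by (simp add: B.m_assoc B.inv_mult_group)
    also have "\<dots> = s \<otimes>\<^bsub>B\<^esub> I \<otimes>\<^bsub>B\<^esub> inv\<^bsub>B\<^esub> s"
      unfolding kI using sB kB IB by (simp add: B.m_assoc)
    finally show "t \<in> S"
      using s IS subgroup.m_closed[OF sS] subgroup.m_inv_closed[OF sS] by metis
  qed
  have Cc: "C \<subseteq> carrier B" using CS Sc by blast
  have "two_subgroup B S" using sS S by (auto simp: two_subgroup_def)
  moreover have "generate B C \<subseteq> S" using B.generate_subgroup_incl[OF CS sS] .
  ultimately have "two_subgroup B (generate B C)"
    using B.two_subgroup_mono B.generate_is_subgroup[OF Cc] by blast
  moreover have "J \<in> generate B C"
  proof (rule generate.incl)
    have "J = \<one>\<^bsub>B\<^esub> \<otimes>\<^bsub>B\<^esub> J \<otimes>\<^bsub>B\<^esub> inv\<^bsub>B\<^esub> \<one>\<^bsub>B\<^esub>" by simp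
    then show "J \<in> C" unfolding C_def using subgroup.one_closed[OF \<Gamma>_subgroup] by blast
  qed
  moreover have "\<Gamma> \<subseteq> nrm B C"
  proof
    have conj: "g \<otimes>\<^bsub>B\<^esub> t \<otimes>\<^bsub>B\<^esub> inv\<^bsub>B\<^esub> g \<in> C" if g: "g \<in> \<Gamma>" and t: "t \<in> C" for g t
    proof -
      obtain h where h: "h \<in> \<Gamma>" "t = h \<otimes>\<^bsub>B\<^esub> J \<otimes>\<^bsub>B\<^esub> inv\<^bsub>B\<^esub> h" using t by (auto simp: C_def)
      then have "g \<otimes>\<^bsub>B\<^esub> t \<otimes>\<^bsub>B\<^esub> inv\<^bsub>B\<^esub> g = (g \<otimes>\<^bsub>B\<^esub> h) \<otimes>\<^bsub>B\<^esub> J \<otimes>\<^bsub>B\<^esub> inv\<^bsub>B\<^esub> (g \<otimes>\<^bsub>B\<^esub> h)"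
        using \<Gamma>c[OF g] \<Gamma>c[OF h(1)] by (simp add: B.m_assoc B.inv_mult_group)
      then show ?thesis unfolding C_def using subgroup.m_closed[OF \<Gamma>_subgroup g h(1)] by blast
    qed
    fix g assume g: "g \<in> \<Gamma>"
    have "inv\<^bsub>B\<^esub> g \<otimes>\<^bsub>B\<^esub> t \<otimes>\<^bsub>B\<^esub> g \<in> C" if "t \<in> C" for t
      using conj[OF subgroup.m_inv_closed[OF \<Gamma>_subgroup g] that] \<Gamma>c[OF g] by simp
    then show "g \<in> nrm B C" using conj[OF g] \<Gamma>c[OF g] by (simp add: nrm_def)
  qed
  ultimately show ?thesis using B.nrm_generate[OF Cc] by blast
qed

text \<open>If \<open>K\<close> meets the multiplication group trivially, the commutators of
  \<open>J\<close> with left translations vanish, so \<open>L x = R (J x)\<close>. At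
  \<open>e\<close> this gives \<open>J x = x\<close>, and the loop is commutative of exponent
  2.\<close>

lemma ex_normal_two_subgroup:
  assumes n: "n \<ge> 1"
  shows "\<exists>N. N \<lhd> G \<and> two_subgroup G N \<and> N \<noteq> {\<one>\<^bsub>G\<^esub>}"
proof -
  obtain K where K: "two_subgroup B K" "J \<in> K" "\<Gamma> \<subseteq> nrm B K"
    using inversion_normal_two_subgroup by blast
  define N where "N = K \<inter> carrier G"
  have sK: "subgroup K B" using K by (simp add: two_subgroup_def)
  have "subgroup N B" unfolding N_def using B.subgroups_Inter_pair sK G_B(2) by blast
  then have tN: "two_subgroup B N" using B.two_subgroup_mono[OF K(1)] by (simp add: N_def)
  have "subgroup N G"
    using B.subgroup_incl[OF \<open>subgroup N B\<close> G_B(2)] by (simp add: N_def Mlt_eq B_def)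
  then have tN: "two_subgroup G N" using tN by (simp add: two_subgroup_def)
  have nN: "N \<lhd> G"
    unfolding G.normal_inv_iff
  proof (intro conjI ballI)
    fix g x assume g: "g \<in> carrier G" and x: "x \<in> N"
    have "g \<otimes>\<^bsub>G\<^esub> x \<otimes>\<^bsub>G\<^esub> inv\<^bsub>G\<^esub> g \<in> carrier G" using g x by (simp add: N_def)
    moreover have "g \<otimes>\<^bsub>B\<^esub> x \<otimes>\<^bsub>B\<^esub> inv\<^bsub>B\<^esub> g \<in> K"
      using g x K(3) G_\<Gamma> by (auto simp: N_def nrm_def)
    ultimately show "g \<otimes>\<^bsub>G\<^esub> x \<otimes>\<^bsub>G\<^esub> inv\<^bsub>G\<^esub> g \<in> N" using G_B g by (simp add: N_def)
  qed (fact \<open>subgroup N G\<close>)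
  show ?thesis
  proof (cases "N = {\<one>\<^bsub>G\<^esub>}")
    case False
    then show ?thesis using nN tN by blast
  next
    case True
    have LR: "L x = R (J x)" if x: "x \<in> Q" for x
    proof -
      \<comment> \<open>This commutator lies in \<open>K\<close>, which contains \<open>J\<close>
        and is normalized by \<open>L x\<close>; it lies in the multiplication group because
        \<open>J\<close> conjugates \<open>L x\<close> to \<open>R (J x)\<close>.\<close>
      let ?t = "L x \<otimes>\<^bsub>B\<^esub> J \<otimes>\<^bsub>B\<^esub> inv\<^bsub>B\<^esub> (L x) \<otimes>\<^bsub>B\<^esub> J"
      have "J \<otimes>\<^bsub>B\<^esub> inv\<^bsub>B\<^esub> (L x) \<otimes>\<^bsub>B\<^esub> J = inv\<^bsub>B\<^esub> (R (J x))"
        unfolding J_L[OF x, symmetric] using x by (simp add: B.inv_mult_group B.m_assoc)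
      then have t: "?t = L x \<otimes>\<^bsub>B\<^esub> inv\<^bsub>B\<^esub> (R (J x))"
        using x by (simp add: B.m_assoc)
      have "L x \<in> nrm B K" by (rule subsetD[OF K(3) subsetD[OF G_\<Gamma> Ltr_closed[OF x]]])
      then have "L x \<otimes>\<^bsub>B\<^esub> J \<otimes>\<^bsub>B\<^esub> inv\<^bsub>B\<^esub> (L x) \<in> K" using K(2) by (auto simp: nrm_def)
      then have "?t \<in> K" using K(2) subgroup.m_closed[OF sK] by blast
      moreover have "?t \<in> carrier G"
        unfolding t using x G_B(2) by (simp add: subgroup.m_closed subgroup.m_inv_closed)
      ultimately have "?t = \<one>\<^bsub>B\<^esub>" using True G_B(4) by (auto simp: N_def)
      then have "L x \<otimes>\<^bsub>B\<^esub> inv\<^bsub>B\<^esub> (R (J x)) = \<one>\<^bsub>B\<^esub>" unfolding t .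
      then show ?thesis using x by (metis B.inv_solve_right B.l_one B.one_closed L_B R_B J_closed)
    qed
    have Jx: "J x = x" if x: "x \<in> Q" for x
    proof -
      have "L x e = R (J x) e" using LR[OF x] by simp
      then show ?thesis using x by simp
    qed
    interpret X: exponent_two_loop G Q L e
    proof
      fix x y assume xy: "x \<in> Q" "y \<in> Q"
      have "L x y = R x y" using LR[OF xy(1)] Jx[OF xy(1)] by simp
      then show "L x y = L y x" using xy by simp
    next
      fix x assume "x \<in> Q"
      then show "L x x = e" using J_right[of x] Jx by simp
    next
      fix \<phi> x y assume "\<phi> \<in> carrier G" "\<phi> e = e" "x \<in> Q" "y \<in> Q"
      then show "\<phi> (L x y) = L (\<phi> x) (\<phi> y)" using inner_aut by simp
    qed simp_all
    show ?thesis using X.ex_normal_two_subgroup[OF finite_M fin card n] .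
  qed
qed

end

theorem theorem3p6:
  fixes Q :: "'a set" and m :: "'a \<Rightarrow> 'a \<Rightarrow> 'a" and e :: 'a
  assumes "simple_loop Q m e" and "automorphic_loop Q m e" and "two_loop Q m e"
  shows "perm_primitive (Mlt Q m) Q \<and> affine_type (Mlt Q m) Q"
proof -
  obtain n where n: "n \<ge> 1" "card Q = 2 ^ n" and "finite Q" "loop Q m e"
    using assms(3) by (auto simp: two_loop_def)
  then interpret automorphic_two Q m e n
    using assms(2) by unfold_locales simp_all
  show ?thesis
    using primitive[OF assms(1)] ex_normal_two_subgroup[OF n(1)]
      affine_of_normal_two_subgroup[OF assms(1)] by blast
qed

end
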